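(* There exists an infinite regular feebly compact $\mathbb{R}$-rigid quasitopological group $H$. Therefore, $H$ is neither completely regular nor functionally Hausdorff.
   Context: A quasitopological group is a group with a topology such that all left and right translations and the inversion are continuous. A space is regular if it is $T_1$ and every open neighborhood $U$ of a point $x$ contains an open neighborhood $V$ of $x$ with $\overline{V}\subseteq U$. A space is feebly compact if every locally finite family of open subsets of it is finite. A space is $\mathbb{R}$-rigid if every continuous real-valued function on it is constant. A space is functionally Hausdorff if continuous real-valued functions on it separate its points. Completely regular means $T_1$ plus: for every closed set $F$ and point $x\notin F$ there is a continuous $f\colon X\to\mathbb{R}$ with $f(x)=1$ and $f(F)\subseteq\{0\}$. *)

theory Defs
  imports "HOL-Analysis.Analysis" "HOL-Algebra.Group"
begin

definition quasitopological_group :: "('a, 'b) monoid_scheme \<Rightarrow> 'a topology \<Rightarrow> bool" where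
  "quasitopological_group G T \<longleftrightarrow>
     group G \<and> topspace T = carrier G \<and>
     (\<forall>a \<in> carrier G. continuous_map T T (\<lambda>x. a \<otimes>\<^bsub>G\<^esub> x)) \<and>
     (\<forall>a \<in> carrier G. continuous_map T T (\<lambda>x. x \<otimes>\<^bsub>G\<^esub> a)) \<and>
     continuous_map T T (\<lambda>x. inv\<^bsub>G\<^esub> x)"

definition regular_T1 :: "'a topology \<Rightarrow> bool" where
  "regular_T1 T \<longleftrightarrow> t1_space T \<and>
     (\<forall>x U. openin T U \<and> x \<in> U \<longrightarrow>
        (\<exists>V. openin T V \<and> x \<in> V \<and> T closure_of V \<subseteq> U))"

definition feebly_compact :: "'a topology \<Rightarrow> bool" where
  "feebly_compact T \<longleftrightarrow>
     (\<forall>\<A>. (\<forall>A \<in> \<A>. openin T A) \<and> locally_finite_in T \<A> \<longrightarrow> finite \<A>)"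

definition R_rigid :: "'a topology \<Rightarrow> bool" where
  "R_rigid T \<longleftrightarrow>
     (\<forall>f. continuous_map T euclideanreal f \<longrightarrow> (\<exists>c. \<forall>x \<in> topspace T. f x = c))"

definition functionally_Hausdorff :: "'a topology \<Rightarrow> bool" where
  "functionally_Hausdorff T \<longleftrightarrow>
     (\<forall>x \<in> topspace T. \<forall>y \<in> topspace T. x \<noteq> y \<longrightarrow>
        (\<exists>f. continuous_map T euclideanreal f \<and> f x \<noteq> f y))"

definition completely_regular_T1 :: "'a topology \<Rightarrow> bool" where
  "completely_regular_T1 T \<longleftrightarrow> t1_space T \<and>
     (\<forall>F x. closedin T F \<and> x \<in> topspace T - F \<longrightarrow>
        (\<exists>f. continuous_map T euclideanreal f \<and> f x = 1 \<and> f ` F \<subseteq> {0}))"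

end

theory Submission
  imports Defs
begin

text \<open>
  Let \<open>Z\<close> be a regular space with points \<open>a \<noteq> b\<close> that no continuous real function separates and
  in which countable sets lie in compact ones (a corkscrew of copies of
  \<open>(\<omega>\<^sub>1 + 1)\<^sup>2\<close> without its corner). In the Vietoris hyperspace of compact sets containing \<open>a\<close>,
  with all those containing \<open>b\<close> collapsed to a point \<open>*\<close>, the map \<open>z \<mapsto> T \<union> {z}\<close> takes \<open>a\<close> to \<open>T\<close> and
  \<open>b\<close> to \<open>*\<close>; so this space \<open>X\<close> is \<open>\<real>\<close>-rigid, and every countable set of finite members lies in
  a compact set. Finally let \<open>G\<close> be a Boolean group with a map \<open>f\<close> into \<open>X\<close> whose translates take
  arbitrarily prescribed values on each countable set (a Korovin map). The topology induced by
  \<open>g \<mapsto> (f (g + h))\<^sub>h\<close> is translation invariant. Cluster points in countable subproducts of \<open>X\<close> make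
  it feebly compact and show that a continuous real function depends, up to \<open>\<epsilon>\<close>, on finitely
  many coordinates, which can be changed one at a time since \<open>X\<close> is \<open>\<real>\<close>-rigid.
\<close>

section \<open>Topologies given by a subbase\<close>

text \<open>The obstacle is that a regular topological group is completely regular, so
  multiplication must not be jointly continuous: the topology is only made invariant under
  translations. In a group where every element is its own inverse nothing else has to be checked,
  hence countable sets under symmetric difference. Rigidity of the group will come from
  \<open>X\<close>, which must therefore be rigid as a whole, whereas \<open>Z\<close> has just one
  bad pair of points. The hyperspace makes a bad pair out of every \<open>T\<close> and one common
  point; the far end must not depend on \<open>T\<close>, hence the collapsing. The price is that
  the union of countably many compact sets need not lie in a compact set. Finite members are dense
  and have countable unions, so compactness is only asked along a dense set, and every cluster
  argument first moves its points into that set. A plank without its corner has two disjoint edges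
  that continuous functions still cannot tell apart far out; disjointness is what allows the edges
  to be glued to different planks.\<close>

lemma generated_nbhd:
  assumes "openin (topology_generated_by S) U" and "x \<in> U"
  obtains F where "finite F" "F \<subseteq> S" "F \<noteq> {}" "x \<in> \<Inter>F" "\<Inter>F \<subseteq> U"
proof -
  have "generate_topology_on S U"
    using assms(1) by (rule openin_topology_generated_by)
  then have "\<exists>F. finite F \<and> F \<subseteq> S \<and> F \<noteq> {} \<and> x \<in> \<Inter>F \<and> \<Inter>F \<subseteq> U"
    using \<open>x \<in> U\<close>
  proof induction
    case Empty
    then show ?case by simp
  next
    case (Int a b)
    then obtain F G where "finite F" "F \<subseteq> S" "F \<noteq> {}" "x \<in> \<Inter>F" "\<Inter>F \<subseteq> a"
      "finite G" "G \<subseteq> S" "x \<in> \<Inter>G" "\<Inter>G \<subseteq> b"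
      by auto
    then show ?case
      by (intro exI[of _ "F \<union> G"]) auto
  next
    case (UN K)
    then obtain k where "k \<in> K" "x \<in> k" by auto
    with UN obtain F where "finite F" "F \<subseteq> S" "F \<noteq> {}" "x \<in> \<Inter>F" "\<Inter>F \<subseteq> k"
      by meson
    with \<open>k \<in> K\<close> show ?case
      by (intro exI[of _ F]) auto
  next
    case (Basis s)
    then show ?case
      by (intro exI[of _ "{s}"]) auto
  qed
  with that show thesis by blast
qed

text \<open>Finitely many closed neighbourhoods may be intersected, so it is enough to find one
  inside each subbasic set. A closed \<open>K\<close> in between is easier to exhibit than the
  closure of \<open>V\<close>.\<close>

lemma regular_T1_generated:
  fixes S :: "'a set set"
  defines "T \<equiv> topology_generated_by S"
  assumes reg: "\<And>s x. s \<in> S \<Longrightarrow> x \<in> s \<Longrightarrow>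
      \<exists>V K. openin T V \<and> closedin T K \<and> x \<in> V \<and> V \<subseteq> K \<and> K \<subseteq> s"
    and sep: "\<And>x y. x \<in> \<Union>S \<Longrightarrow> y \<in> \<Union>S \<Longrightarrow> x \<noteq> y \<Longrightarrow> \<exists>U. openin T U \<and> x \<in> U \<and> y \<notin> U"
  shows "regular_T1 T"
  unfolding regular_T1_def
proof (intro conjI allI impI)
  show "t1_space T"
    unfolding t1_space_def using sep by (simp add: T_def)
next
  fix x U assume "openin T U \<and> x \<in> U"
  then obtain F where F: "finite F" "F \<subseteq> S" "F \<noteq> {}" "x \<in> \<Inter>F" "\<Inter>F \<subseteq> U"
    unfolding T_def by (meson generated_nbhd)
  have "\<forall>s\<in>F. \<exists>V K. openin T V \<and> closedin T K \<and> x \<in> V \<and> V \<subseteq> K \<and> K \<subseteq> s"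
    using reg F by blast
  then obtain V K where VK: "\<And>s. s \<in> F \<Longrightarrow> openin T (V s)" "\<And>s. s \<in> F \<Longrightarrow> closedin T (K s)"
    "\<And>s. s \<in> F \<Longrightarrow> x \<in> V s" "\<And>s. s \<in> F \<Longrightarrow> V s \<subseteq> K s" "\<And>s. s \<in> F \<Longrightarrow> K s \<subseteq> s"
    by metis
  have "openin T (\<Inter>(V ` F))"
    using F VK by (intro openin_Inter) auto
  have *: "T closure_of (\<Inter>(V ` F)) \<subseteq> \<Inter>(K ` F)"
  proof (rule closure_of_minimal)
    show "\<Inter>(V ` F) \<subseteq> \<Inter>(K ` F)"
      by (rule INF_mono) (use VK(4) in blast)
      show "closedin T (\<Inter>(K ` F))"
      using F(3) VK(2) by (intro closedin_INT) auto
  qed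
  show "\<exists>V. openin T V \<and> x \<in> V \<and> T closure_of V \<subseteq> U"
  proof (intro exI conjI)
    show "x \<in> \<Inter>(V ` F)" using VK(3) by blast
    show "openin T (\<Inter>(V ` F))" by fact
    have "\<Inter>(K ` F) \<subseteq> \<Inter>F" using VK(5) by blast
    then show "T closure_of \<Inter>(V ` F) \<subseteq> U"
      using * F(5) by blast
  qed
qed

lemma limitin_generated:
  assumes "l \<in> \<Union>S" and "\<And>s. s \<in> S \<Longrightarrow> l \<in> s \<Longrightarrow> eventually (\<lambda>x. f x \<in> s) F"
  shows "limitin (topology_generated_by S) f l F"
  unfolding limitin_def
proof (intro conjI allI impI)
  show "l \<in> topspace (topology_generated_by S)" using assms by simp
next
  fix U assume "openin (topology_generated_by S) U \<and> l \<in> U"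
  then obtain G where G: "finite G" "G \<subseteq> S" "G \<noteq> {}" "l \<in> \<Inter>G" "\<Inter>G \<subseteq> U"
    by (meson generated_nbhd)
  then have "eventually (\<lambda>x. \<forall>s\<in>G. f x \<in> s) F"
    using assms by (intro eventually_ball_finite) auto
  then show "eventually (\<lambda>x. f x \<in> U) F"
    by eventually_elim (use G in auto)
qed

lemma compactin_generated:
  assumes "K \<subseteq> \<Union>S"
    and "\<And>C. C \<subseteq> S \<Longrightarrow> K \<subseteq> \<Union>C \<Longrightarrow> \<exists>C'. finite C' \<and> C' \<subseteq> C \<and> K \<subseteq> \<Union>C'"
  shows "compactin (topology_generated_by S) K"
proof -
  \<comment> \<open>The form in which Alexander's subbase lemma is stated. There the empty
    intersection counts and gives \<open>K\<close> itself, while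
    \<open>topology_generated_by\<close> has only nonempty ones; hence the separate case
    \<open>F = {}\<close> below.\<close>
  let ?B = "topology (arbitrary union_of (finite intersection_of (\<lambda>x. x \<in> S) relative_to K))"
  have "compact_space ?B"
    using assms by (intro Alexander_subbase_alt[OF _ _ refl])
  moreover have opB: "openin ?B = arbitrary union_of (finite intersection_of (\<lambda>x. x \<in> S) relative_to K)"
    by (simp add: istopology_subbase)
  have "subtopology (topology_generated_by S) K = ?B"
    unfolding topology_eq
  proof (intro allI iffI)
    fix U assume "openin (subtopology (topology_generated_by S) K) U"
    then obtain W where W: "openin (topology_generated_by S) W" "U = W \<inter> K"
      by (auto simp: openin_subtopology)
    have "\<exists>V. openin ?B V \<and> x \<in> V \<and> V \<subseteq> U" if "x \<in> U" for x
    proof -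
      obtain F where F: "finite F" "F \<subseteq> S" "F \<noteq> {}" "x \<in> \<Inter>F" "\<Inter>F \<subseteq> W"
      proof (rule generated_nbhd[OF W(1)])
        show "x \<in> W" using W(2) \<open>x \<in> U\<close> by simp
      qed
      have "(finite intersection_of (\<lambda>x. x \<in> S)) (\<Inter>F)"
        using F unfolding intersection_of_def by blast
      then have "(finite intersection_of (\<lambda>x. x \<in> S) relative_to K) (K \<inter> \<Inter>F)"
        by (rule relative_to_inc)
      then have "openin ?B (K \<inter> \<Inter>F)"
        unfolding opB by (rule union_of_inc[rotated]) (simp add: arbitrary_def)
      then show ?thesis using F W that by blast
    qed
    then show "openin ?B U" by (subst openin_subopen) blast
  next
    fix U assume "openin ?B U"
    then obtain \<U> where U: "\<Union>\<U> = U"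
      "\<And>V. V \<in> \<U> \<Longrightarrow> (finite intersection_of (\<lambda>x. x \<in> S) relative_to K) V"
      using fun_cong[OF opB, of U] unfolding union_of_def by auto
    have "openin (subtopology (topology_generated_by S) K) V" if V: "V \<in> \<U>" for V
    proof -
      obtain F where F: "finite F" "F \<subseteq> S" "V = K \<inter> \<Inter>F"
        using U(2)[OF V] unfolding relative_to_def intersection_of_def by auto
      show ?thesis
      proof (cases "F = {}")
        case True
        then have "V = K" using F by simp
        then show ?thesis using assms(1)
          by (metis openin_topspace topspace_subtopology_subset topology_generated_by_topspace)
      next
        case False
        then have "openin (topology_generated_by S) (\<Inter>F)"
          using F by (intro openin_Inter) (auto intro: topology_generated_by_Basis)
        then show ?thesis using F by (simp add: openin_subtopology_Int2)
      qed
    qed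
    then show "openin (subtopology (topology_generated_by S) K) U"
      using U(1) by blast
  qed
  ultimately show ?thesis
    using assms(1) by (simp add: compactin_subspace)
qed

section \<open>The first uncountable ordinal\<close>

text \<open>A copy is taken because \<open>nat set\<close> is already ordered by inclusion. For the
  ordinals it only matters that the type is uncountable.\<close>

typedef ordw = "UNIV :: nat set set" by simp

text \<open>An arbitrary well-order with \<open>{}\<close> moved to the top, so that at least one element has
  uncountably many predecessors.\<close>

definition top_le :: "nat set \<Rightarrow> nat set \<Rightarrow> bool" where
  "top_le x y \<longleftrightarrow> y = {} \<or> (x \<noteq> {} \<and> (x, y) \<in> (SOME r. well_order_on UNIV r))"

lemma well_order_SOME: "well_order_on UNIV (SOME r :: 'a rel. well_order_on UNIV r)"
  using well_order_on someI_ex by metis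

instantiation ordw :: linorder
begin

definition "x \<le> y \<longleftrightarrow> top_le (Rep_ordw x) (Rep_ordw y)"
definition "(x::ordw) < y \<longleftrightarrow> x \<le> y \<and> \<not> y \<le> x"

instance
proof
  let ?r = "SOME r :: nat set rel. well_order_on UNIV r"
  have lin: "linear_order_on UNIV ?r"
    using well_order_SOME unfolding well_order_on_def by blast
  have refl: "(u, u) \<in> ?r" for u
    using lin unfolding order_on_defs refl_on_def by blast
  have tr: "(u, v) \<in> ?r \<Longrightarrow> (v, w) \<in> ?r \<Longrightarrow> (u, w) \<in> ?r" for u v w
    using lin unfolding order_on_defs trans_def by blast
  have anti: "(u, v) \<in> ?r \<Longrightarrow> (v, u) \<in> ?r \<Longrightarrow> u = v" for u v
    using lin unfolding order_on_defs antisym_def by blast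
  have tot: "(u, v) \<in> ?r \<or> (v, u) \<in> ?r" for u v
    using lin refl unfolding order_on_defs total_on_def by (cases "u = v") auto
  fix x y z :: ordw
  show "x < y \<longleftrightarrow> x \<le> y \<and> \<not> y \<le> x" by (simp add: less_ordw_def)
  show "x \<le> x" using refl by (auto simp: less_eq_ordw_def top_le_def)
  show "x \<le> z" if "x \<le> y" "y \<le> z"
    using that tr by (auto simp: less_eq_ordw_def top_le_def)
  show "x = y" if "x \<le> y" "y \<le> x"
    using that anti by (auto simp: less_eq_ordw_def top_le_def simp flip: Rep_ordw_inject)
  show "x \<le> y \<or> y \<le> x"
    using tot by (auto simp: less_eq_ordw_def top_le_def)
qed

end

instance ordw :: wellorder
proof
  fix P :: "ordw \<Rightarrow> bool" and a
  assume step: "\<And>x. (\<And>y. y < x \<Longrightarrow> P y) \<Longrightarrow> P x"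
  let ?r = "SOME r :: nat set rel. well_order_on UNIV r"
  have wf: "wf (?r - Id)"
    using well_order_SOME unfolding well_order_on_def by blast
  \<comment> \<open>Away from the top the order is that of \<open>?r\<close>, so well-founded
    induction applies; the top then has only such predecessors.\<close>
  have P: "P x" if "Rep_ordw x = u" "u \<noteq> {}" for x u
    using wf that
  proof (induction u arbitrary: x)
    case (less u)
    show ?case
    proof (rule step)
      fix y assume "y < x"
      then have "Rep_ordw y \<noteq> {}" "(Rep_ordw y, u) \<in> ?r" "y \<noteq> x"
        using less.prems by (auto simp: less_ordw_def less_eq_ordw_def top_le_def)
      moreover have "Rep_ordw y \<noteq> u"
        using \<open>y \<noteq> x\<close> less.prems Rep_ordw_inject by metis
      ultimately show "P y" using less.IH by blast
    qed
  qed
  show "P a"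
  proof (rule step)
    fix y assume "y < a"
    then have "Rep_ordw y \<noteq> {}"
      by (auto simp: less_ordw_def less_eq_ordw_def top_le_def)
    then show "P y" using P by blast
  qed
qed

lemma uncountable_UNIV_nat_set: "uncountable (UNIV :: nat set set)"
proof
  assume "countable (UNIV :: nat set set)"
  then have "range (from_nat_into (UNIV :: nat set set)) = UNIV"
    by (simp add: range_from_nat_into)
  then show False using Cantors_theorem[of "UNIV::nat set"]
    by (metis Pow_UNIV)
qed

definition omega1 :: ordw where
  "omega1 = (LEAST x. uncountable {..<x})"

lemma uncountable_lessThan_omega1: "uncountable {..<omega1}"
proof -
  have "uncountable {..<Abs_ordw {}}"
  proof
    assume "countable {..<Abs_ordw {}}"
    then have "countable (Rep_ordw ` {..<Abs_ordw {}})" by blast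
    moreover have "- {{}} \<subseteq> Rep_ordw ` {..<Abs_ordw {}}"
    proof
      fix u :: "nat set" assume "u \<in> - {{}}"
      then have "Abs_ordw u < Abs_ordw {}"
        by (auto simp: less_ordw_def less_eq_ordw_def top_le_def Abs_ordw_inverse)
      then show "u \<in> Rep_ordw ` {..<Abs_ordw {}}"
        by (intro image_eqI[of _ _ "Abs_ordw u"]) (auto simp: Abs_ordw_inverse)
    qed
    ultimately have "countable (- {{}} :: nat set set)"
      by (rule countable_subset[rotated])
    then have "countable (insert {} (- {{}} :: nat set set))" by simp
    then show False using uncountable_UNIV_nat_set
      by (metis Compl_partition2 Un_commute insert_is_Un)
  qed
  then show ?thesis unfolding omega1_def by (rule LeastI)
qed

lemma countable_lessThan: "x < omega1 \<Longrightarrow> countable {..<x}"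
  unfolding omega1_def using not_less_Least by blast

text \<open>Uncountable cofinality: countably many countable initial segments \<open>{..x}\<close>
  cannot exhaust the uncountable \<open>{..<omega1}\<close>. With \<open>A = {}\<close> this also
  provides some ordinal below \<open>omega1\<close>.\<close>

lemma bounded_omega1:
  assumes "countable A" "A \<subseteq> {..<omega1}"
  shows "\<exists>g<omega1. \<forall>x\<in>A. x < g"
proof -
  have "countable {..x}" if "x \<in> A" for x
  proof -
    have "{..x} = insert x {..<x}" by auto
    then show ?thesis using that assms countable_lessThan by auto
  qed
  then have "countable (\<Union>x\<in>A. {..x})" using assms by blast
  then have "\<not> {..<omega1} \<subseteq> (\<Union>x\<in>A. {..x})"
    using uncountable_lessThan_omega1 countable_subset by blast
  then obtain g where "g < omega1" "g \<notin> (\<Union>x\<in>A. {..x})" by blast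
  then show ?thesis by (meson UN_I atMost_iff not_le)
qed

section \<open>The corkscrew\<close>

text \<open>The \<open>n\<close>-th plank consists of the points \<open>cork_pt n x y\<close>; its edge \<open>x = omega1\<close> is the edge
  \<open>y = omega1\<close> of the next one. A point other than the two ends is given by an integer-indexed sequence that
  differs from \<open>omega1\<close> only at \<open>n\<close> or \<open>n + 1\<close>. The second component merely distinguishes the ends,
  which are both constantly \<open>omega1\<close>.\<close>

definition cork_left :: "(int \<Rightarrow> ordw) \<times> int" where
  "cork_left = ((\<lambda>_. omega1), -1)"

definition cork_right :: "(int \<Rightarrow> ordw) \<times> int" where
  "cork_right = ((\<lambda>_. omega1), 1)"

definition cork_pt :: "int \<Rightarrow> ordw \<Rightarrow> ordw \<Rightarrow> (int \<Rightarrow> ordw) \<times> int" where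
  "cork_pt n x y = ((\<lambda>_. omega1)(n := x, n + 1 := y), 0)"

definition cork_set :: "((int \<Rightarrow> ordw) \<times> int) set" where
  "cork_set = {cork_left, cork_right} \<union>
     {cork_pt n x y | n x y. x < omega1 \<and> y \<le> omega1}
     \<union> {cork_pt n x y | n x y. x \<le> omega1 \<and> y < omega1}"

text \<open>The first two are the preimages of the basic clopen sets \<open>[0, g]\<close> and
  \<open>(g, omega1]\<close> of the ordinal space under the \<open>j\<close>-th coordinate.
  Coordinates cannot tell the two ends apart; the other two sets do, being neighbourhoods of one end
  that avoid the other.\<close>

definition cork_low where "cork_low j g = {p \<in> cork_set. fst p j \<le> g}"
definition cork_high where "cork_high j g = {p \<in> cork_set. g < fst p j}"
definition cork_rightof where
  "cork_rightof k = {p \<in> cork_set. p = cork_right \<or> (\<exists>j\<ge>k. fst p j < omega1)}"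
definition cork_leftof where
  "cork_leftof k = {p \<in> cork_set. p = cork_left \<or> (\<exists>j\<le>k. fst p j < omega1)}"

definition cork_subbase :: "((int \<Rightarrow> ordw) \<times> int) set set" where
  "cork_subbase = {cork_low j g | j g. g < omega1} \<union> {cork_high j g | j g. g < omega1}
     \<union> range cork_rightof \<union> range cork_leftof"

definition cork :: "((int \<Rightarrow> ordw) \<times> int) topology" where
  "cork = topology_generated_by cork_subbase"

lemma cork_pt_swap: "cork_pt n omega1 y = cork_pt (n + 1) y omega1"
  unfolding cork_pt_def by auto

lemma fst_cork_pt:
  "fst (cork_pt n x y) j = (if j = n + 1 then y else if j = n then x else omega1)"
  by (simp add: cork_pt_def)

lemma fst_cork_ends [simp]: "fst cork_left j = omega1" "fst cork_right j = omega1"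
  by (simp_all add: cork_left_def cork_right_def)

lemma cork_ends_distinct [simp]: "cork_left \<noteq> cork_right" "cork_right \<noteq> cork_left"
  "cork_pt n x y \<noteq> cork_left" "cork_pt n x y \<noteq> cork_right"
  by (simp_all add: cork_left_def cork_right_def cork_pt_def)

lemma cork_ends_in [simp]: "cork_left \<in> cork_set" "cork_right \<in> cork_set"
  by (simp_all add: cork_set_def)

lemma cork_pt_in: "x < omega1 \<and> y \<le> omega1 \<or> x \<le> omega1 \<and> y < omega1 \<Longrightarrow> cork_pt n x y \<in> cork_set"
  unfolding cork_set_def by blast

lemma cork_cases:
  assumes "p \<in> cork_set"
  obtains "p = cork_left" | "p = cork_right"
  | n x y where "p = cork_pt n x y" "x < omega1" "y \<le> omega1"
proof -
  have "\<exists>n x y. p = cork_pt n x y \<and> x < omega1 \<and> y \<le> omega1"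
    if "p = cork_pt n x y" "x \<le> omega1" "y < omega1" for n x y
  proof (cases "x = omega1")
    case True
    then have "p = cork_pt (n + 1) y omega1" using that cork_pt_swap by simp
    then show ?thesis using that by blast
  qed (use that in force)
  with assms that show thesis unfolding cork_set_def by blast
qed

lemma cork_le: "p \<in> cork_set \<Longrightarrow> fst p j \<le> omega1"
  by (erule cork_cases) (auto simp: fst_cork_pt)

lemma cork_adjacent:
  assumes "p \<in> cork_set" "fst p i < omega1" "fst p j < omega1"
  shows "\<bar>i - j\<bar> \<le> 1"
  using assms by (auto elim!: cork_cases simp: fst_cork_pt split: if_splits)

lemma cork_support:
  assumes "p \<in> cork_set" "p \<noteq> cork_left" "p \<noteq> cork_right"
  obtains j where "fst p j < omega1"
  using assms(1)
proof (cases rule: cork_cases)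
  case (3 n x y)
  then have "fst p n < omega1" by (simp add: fst_cork_pt)
  then show thesis by (rule that)
qed (use assms in auto)

lemma cork_leftof_rightof_disjoint:
  assumes "k + 1 < l" "p \<in> cork_leftof k"
  shows "p \<notin> cork_rightof l"
proof
  assume "p \<in> cork_rightof l"
  with assms(2) obtain i j where "i \<le> k" "l \<le> j" "fst p i < omega1" "fst p j < omega1" "p \<in> cork_set"
    unfolding cork_leftof_def cork_rightof_def by auto
  with cork_adjacent[of p i j] assms(1) show False by linarith
qed

lemma cork_leftof_subset: "cork_leftof k \<subseteq> cork_set" "cork_rightof k \<subseteq> cork_set"
  unfolding cork_leftof_def cork_rightof_def by auto

lemma cork_eqI:
  assumes "p \<in> cork_set" "q \<in> cork_set" "fst p = fst q"
  shows "p = q \<or> p \<in> {cork_left, cork_right} \<and> q \<in> {cork_left, cork_right}"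
proof -
  have "snd p = 0 \<and> (\<exists>j. fst p j \<noteq> omega1) \<or> p \<in> {cork_left, cork_right} \<and> (\<forall>j. fst p j = omega1)"
    if "p \<in> cork_set" for p
    using that
  proof (cases rule: cork_cases)
    case (3 n x y)
    then have "fst p n \<noteq> omega1" "snd p = 0" by (auto simp: fst_cork_pt cork_pt_def)
    then show ?thesis by blast
  qed auto
  from this[OF assms(1)] this[OF assms(2)] show ?thesis
    using assms(3) by (metis prod_eqI)
qed

lemma Union_cork_subbase: "\<Union>cork_subbase = cork_set"
proof -
  obtain g where "g < omega1" using bounded_omega1[of "{}"] by auto
  then have "cork_low 0 g \<in> cork_subbase" "cork_high 0 g \<in> cork_subbase"
    unfolding cork_subbase_def by blast+
  moreover have "cork_low 0 g \<union> cork_high 0 g = cork_set"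
    unfolding cork_low_def cork_high_def by auto
  moreover have "s \<subseteq> cork_set" if "s \<in> cork_subbase" for s
    using that unfolding cork_subbase_def cork_low_def cork_high_def cork_rightof_def cork_leftof_def
    by auto
  ultimately show ?thesis by blast
qed

lemma topspace_cork [simp]: "topspace cork = cork_set"
  unfolding cork_def by (simp add: Union_cork_subbase)

lemma openin_cork [simp]:
  "g < omega1 \<Longrightarrow> openin cork (cork_low j g)" "g < omega1 \<Longrightarrow> openin cork (cork_high j g)"
  "openin cork (cork_rightof k)" "openin cork (cork_leftof k)"
  unfolding cork_def by (auto intro!: topology_generated_by_Basis simp: cork_subbase_def)

section \<open>Regularity of the corkscrew\<close>

lemma closedin_cork_low: "g < omega1 \<Longrightarrow> closedin cork (cork_low j g)"
proof -
  assume "g < omega1"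
  moreover have "cork_set - cork_low j g = cork_high j g" unfolding cork_low_def cork_high_def by auto
  ultimately show ?thesis unfolding closedin_def by (auto simp: cork_low_def)
qed

lemma closedin_cork_high: "g < omega1 \<Longrightarrow> closedin cork (cork_high j g)"
proof -
  assume "g < omega1"
  moreover have "cork_set - cork_high j g = cork_low j g" unfolding cork_low_def cork_high_def by auto
  ultimately show ?thesis unfolding closedin_def by (auto simp: cork_high_def)
qed

text \<open>At the end itself, the complement of \<open>cork_leftof (k - 1)\<close> is a closed set
  between \<open>cork_rightof (k + 1)\<close> and \<open>cork_rightof k\<close>. The gap of two is
  forced, since a point may have two adjacent coordinates below \<open>omega1\<close>. Any other
  point has a coordinate below \<open>omega1\<close>, which gives a clopen neighbourhood of the form
  \<open>cork_low\<close>.\<close>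

lemma cork_rightof_nbhd:
  assumes "s = cork_rightof k" "x \<in> s"
  shows "\<exists>V K. openin cork V \<and> closedin cork K \<and> x \<in> V \<and> V \<subseteq> K \<and> K \<subseteq> s"
proof (cases "x = cork_right")
  case True
  have "cork_rightof (k + 1) \<subseteq> cork_set - cork_leftof (k - 1)"
    using cork_leftof_rightof_disjoint[of "k - 1" "k + 1", simplified] cork_leftof_subset by blast
  moreover have "cork_set - cork_leftof (k - 1) \<subseteq> cork_rightof k"
  proof
    fix p assume p: "p \<in> cork_set - cork_leftof (k - 1)"
    then have "p \<noteq> cork_left" "\<forall>j\<le>k-1. \<not> fst p j < omega1" by (auto simp: cork_leftof_def)
    show "p \<in> cork_rightof k"
    proof (cases "p = cork_right")
      case False
      with p \<open>p \<noteq> cork_left\<close> obtain j where "fst p j < omega1"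
        using cork_support[of p] by blast
      moreover from this have "k \<le> j"
        using \<open>\<forall>j\<le>k-1. \<not> fst p j < omega1\<close> by force
      ultimately show ?thesis using p by (auto simp: cork_rightof_def)
    qed (simp add: cork_rightof_def)
  qed
  moreover have "closedin cork (cork_set - cork_leftof (k - 1))"
    using closedin_diff[of cork cork_set "cork_leftof (k-1)"] closedin_topspace[of cork] by simp
  moreover have "x \<in> cork_rightof (k + 1)"
    using True by (simp add: cork_rightof_def)
  ultimately show ?thesis unfolding assms(1) using openin_cork(3) by blast
next
  case False
  with assms obtain j where j: "j \<ge> k" "fst x j < omega1" "x \<in> cork_set"
    unfolding cork_rightof_def by auto
  then have "cork_low j (fst x j) \<subseteq> s" "x \<in> cork_low j (fst x j)"
    unfolding assms cork_low_def cork_rightof_def by auto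
  moreover note closedin_cork_low[OF j(2), of j] openin_cork(1)[OF j(2), of j]
  ultimately show ?thesis by blast
qed

lemma cork_leftof_nbhd:
  assumes "s = cork_leftof k" "x \<in> s"
  shows "\<exists>V K. openin cork V \<and> closedin cork K \<and> x \<in> V \<and> V \<subseteq> K \<and> K \<subseteq> s"
proof (cases "x = cork_left")
  case True
  have "cork_leftof (k - 1) \<subseteq> cork_set - cork_rightof (k + 1)"
    using cork_leftof_rightof_disjoint[of "k - 1" "k + 1", simplified] cork_leftof_subset by blast
  moreover have "cork_set - cork_rightof (k + 1) \<subseteq> cork_leftof k"
  proof
    fix p assume p: "p \<in> cork_set - cork_rightof (k + 1)"
    then have "p \<noteq> cork_right" "\<forall>j\<ge>k+1. \<not> fst p j < omega1" by (auto simp: cork_rightof_def)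
    show "p \<in> cork_leftof k"
    proof (cases "p = cork_left")
      case False
      with p \<open>p \<noteq> cork_right\<close> obtain j where "fst p j < omega1"
        using cork_support[of p] by blast
      moreover from this have "j \<le> k"
        using \<open>\<forall>j\<ge>k+1. \<not> fst p j < omega1\<close> by (meson not_le zless_imp_add1_zle)
      ultimately show ?thesis using p by (auto simp: cork_leftof_def)
    qed (simp add: cork_leftof_def)
  qed
  moreover have "closedin cork (cork_set - cork_rightof (k + 1))"
    using closedin_diff[of cork cork_set "cork_rightof (k+1)"] closedin_topspace[of cork] by simp
  moreover have "x \<in> cork_leftof (k - 1)"
    using True by (simp add: cork_leftof_def)
  ultimately show ?thesis unfolding assms(1) using openin_cork(4) by blast
next
  case False
  with assms obtain j where j: "j \<le> k" "fst x j < omega1" "x \<in> cork_set"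
    unfolding cork_leftof_def by auto
  then have "cork_low j (fst x j) \<subseteq> s" "x \<in> cork_low j (fst x j)"
    unfolding assms cork_low_def cork_leftof_def by auto
  moreover note closedin_cork_low[OF j(2), of j] openin_cork(1)[OF j(2), of j]
  ultimately show ?thesis by blast
qed

lemma regular_T1_cork: "regular_T1 cork"
  unfolding cork_def
proof (rule regular_T1_generated)
  fix s x assume "s \<in> cork_subbase" "x \<in> s"
  then consider j g where "s = cork_low j g" "g < omega1" | j g where "s = cork_high j g" "g < omega1"
    | k where "s = cork_rightof k" | k where "s = cork_leftof k"
    unfolding cork_subbase_def by blast
  then have "\<exists>V K. openin cork V \<and> closedin cork K \<and> x \<in> V \<and> V \<subseteq> K \<and> K \<subseteq> s"
  proof cases
    case 1
    then show ?thesis using \<open>x \<in> s\<close> closedin_cork_low[of g j] openin_cork(1)[of g j] by blast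
  next
    case 2
    then show ?thesis using \<open>x \<in> s\<close> closedin_cork_high[of g j] openin_cork(2)[of g j] by blast
  next
    case 3
    then show ?thesis using \<open>x \<in> s\<close> by (rule cork_rightof_nbhd)
  next
    case 4
    then show ?thesis using \<open>x \<in> s\<close> by (rule cork_leftof_nbhd)
  qed
  then show "\<exists>V K. openin (topology_generated_by cork_subbase) V \<and>
      closedin (topology_generated_by cork_subbase) K \<and> x \<in> V \<and> V \<subseteq> K \<and> K \<subseteq> s"
    unfolding cork_def .
next
  fix p q assume pq: "p \<in> \<Union>cork_subbase" "q \<in> \<Union>cork_subbase" "p \<noteq> q"
  then have Z: "p \<in> cork_set" "q \<in> cork_set" by (simp_all add: Union_cork_subbase)
  have "\<exists>U. openin cork U \<and> p \<in> U \<and> q \<notin> U"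
  proof (cases "fst p = fst q")
    case True
    then have "p = cork_left \<and> q = cork_right \<or> p = cork_right \<and> q = cork_left"
      using cork_eqI[OF Z True] pq(3) by auto
    moreover have "cork_left \<in> cork_leftof 0" "cork_right \<notin> cork_leftof 0"
      "cork_left \<notin> cork_rightof 0" "cork_right \<in> cork_rightof 0"
      by (auto simp: cork_leftof_def cork_rightof_def)
    ultimately show ?thesis using openin_cork(3,4)[of 0] by blast
  next
    case False
    then obtain j where "fst p j \<noteq> fst q j" by auto
    then consider "fst p j < fst q j" | "fst q j < fst p j" by fastforce
    then show ?thesis
    proof cases
      case 1
      then have "p \<in> cork_low j (fst p j)" "q \<notin> cork_low j (fst p j)" "fst p j < omega1"
        using Z cork_le[OF Z(2), of j] by (auto simp: cork_low_def)
      then show ?thesis using openin_cork(1) by blast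
    next
      case 2
      then have "p \<in> cork_high j (fst q j)" "q \<notin> cork_high j (fst q j)" "fst q j < omega1"
        using Z cork_le[OF Z(1), of j] by (auto simp: cork_high_def)
      then show ?thesis using openin_cork(2) by blast
    qed
  qed
  then show "\<exists>U. openin (topology_generated_by cork_subbase) U \<and> p \<in> U \<and> q \<notin> U"
    unfolding cork_def .
qed

section \<open>Countable subsets of the corkscrew lie in compact sets\<close>

lemma cork_subbase_cases:
  assumes "s \<in> cork_subbase"
  obtains (low) j g where "s = cork_low j g" "g < omega1"
  | (high) j g where "s = cork_high j g" "g < omega1"
  | (right) k where "s = cork_rightof k" | (left) k where "s = cork_leftof k"
  using assms unfolding cork_subbase_def by blast

text \<open>Away from the ends, only the sets \<open>cork_high\<close> can be left by lowering
  coordinates. So in a cover, the set containing the largest point \<open>q\<close> of some piece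
  contains the whole piece unless it is a \<open>cork_high\<close>.\<close>

lemma cork_subbase_mono:
  assumes "s \<in> cork_subbase" "q \<in> s" "q \<noteq> cork_left" "q \<noteq> cork_right"
    and "p \<in> cork_set" "\<And>l. fst p l \<le> fst q l"
  shows "p \<in> s \<or> (\<exists>l t. s = cork_high l t \<and> t < omega1 \<and> t < fst q l)"
  using assms(1)
proof (cases rule: cork_subbase_cases)
  case (low j g)
  then show ?thesis using assms(2,5) order_trans[OF assms(6)[of j]] by (auto simp: cork_low_def)
next
  case (high j g)
  then show ?thesis using assms(2) by (auto simp: cork_high_def)
next
  case (right k)
  then show ?thesis using assms order_le_less_trans[OF assms(6)] by (auto simp: cork_rightof_def)
next
  case (left k)
  then show ?thesis using assms order_le_less_trans[OF assms(6)] by (auto simp: cork_leftof_def)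
qed

text \<open>The corkscrew rebuilt from \<open>[0, g]\<close> and \<open>omega1\<close>. The gap
  above \<open>g\<close> makes \<open>omega1\<close> isolated there, so the missing corner of a
  plank is an isolated point and its absence does not spoil compactness.\<close>

definition cork_below :: "ordw \<Rightarrow> ((int \<Rightarrow> ordw) \<times> int) set" where
  "cork_below g = {p \<in> cork_set. \<forall>j. fst p j \<le> g \<or> fst p j = omega1}"

text \<open>At most three sets are enough. By minimality \<open>cork_high i (\<mu> i)\<close> is the
  largest set of its kind in the cover. What \<open>cork_high j (\<mu> j)\<close> leaves over lies
  below \<open>q\<close>. The set covering \<open>q\<close> either takes all of that or is a
  \<open>cork_high\<close> at a neighbouring coordinate \<open>l\<close>, as minimality excludes
  \<open>j\<close>. What then remains after adding \<open>cork_high l (\<mu> l)\<close> lies below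
  \<open>r\<close>, and the set covering \<open>r\<close> takes it all.\<close>

lemma cork_below_cover_high:
  assumes C: "C \<subseteq> cork_subbase" "cork_below g \<subseteq> \<Union>C" and g: "g < omega1"
    and hi: "cork_high j d \<in> C" "d < omega1"
  shows "\<exists>C'. finite C' \<and> C' \<subseteq> C \<and> cork_below g \<subseteq> \<Union>C'"
proof -
  define \<mu> where "\<mu> i = (LEAST d. cork_high i d \<in> C \<and> d < omega1)" for i
  have least: "cork_high i (\<mu> i) \<in> C \<and> \<mu> i < omega1" if "cork_high i d \<in> C" "d < omega1" for i d
    unfolding \<mu>_def by (rule LeastI2[of _ d]) (use that in auto)
  have minimal: "\<mu> i \<le> d" if "cork_high i d \<in> C" "d < omega1" for i d
    unfolding \<mu>_def by (rule Least_le) (use that in auto)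
  \<comment> \<open>The minimum with \<open>g\<close> puts \<open>q\<close> and \<open>r\<close>
    into \<open>cork_below g\<close>; no point of \<open>cork_below g\<close> has a coordinate
    strictly between \<open>g\<close> and \<open>omega1\<close>, so nothing is lost.\<close>
  define \<nu> where "\<nu> i = min (\<mu> i) g" for i
  have \<nu>: "\<nu> i < omega1" "\<nu> i \<le> g" "\<nu> i \<le> \<mu> i" for i
    using g by (auto simp: \<nu>_def min_less_iff_disj)
  have out: "fst p i \<le> \<nu> i" if "p \<in> cork_below g" "p \<notin> cork_high i (\<mu> i)" "\<mu> i < omega1" for p i
    using that unfolding cork_below_def cork_high_def \<nu>_def by (cases "fst p i = omega1") auto
  define q where "q = cork_pt j (\<nu> j) omega1"
  have q: "q \<in> cork_below g" "q \<noteq> cork_left" "q \<noteq> cork_right"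
    unfolding q_def cork_below_def using \<nu>[of j] by (auto simp: fst_cork_pt intro!: cork_pt_in)
  have fq: "fst q l = (if l = j then \<nu> j else omega1)" for l
    by (simp add: q_def fst_cork_pt)
  obtain s where s: "s \<in> C" "q \<in> s" using C(2) q by blast
  have hij: "cork_high j (\<mu> j) \<in> C" "\<mu> j < omega1" using least[OF hi] by auto
  show ?thesis
  proof (cases "\<forall>p\<in>cork_set. fst p j \<le> \<nu> j \<longrightarrow> p \<in> s")
    case True
    then have "cork_below g \<subseteq> s \<union> cork_high j (\<mu> j)"
      using out[of _ j] hij unfolding cork_below_def by blast
    then show ?thesis using s hij by (intro exI[of _ "{s, cork_high j (\<mu> j)}"]) auto
  next
    case False
    then obtain p where p: "p \<in> cork_set" "fst p j \<le> \<nu> j" "p \<notin> s" by blast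
    have "fst p l \<le> fst q l" for l
      using p cork_le[OF p(1), of l] by (simp add: fq)
    then obtain l t where lt: "s = cork_high l t" "t < omega1" "t < fst q l"
      using cork_subbase_mono[of s q p] s C q p by blast
    have "l \<noteq> j"
    proof
      assume "l = j"
      then have "t < \<mu> j" "cork_high j t \<in> C"
        using lt s fq[of j] \<nu>(3)[of j] by auto
      then show False using minimal[of j t] lt by auto
    qed
    moreover have "\<bar>l - j\<bar> \<le> 1"
    proof (rule cork_adjacent[OF p(1)])
      show "fst p j < omega1" using p \<nu>(1)[of j] by order
      have "fst p l \<le> t" using p lt by (auto simp: cork_high_def)
      then show "fst p l < omega1" using lt by order
    qed
    ultimately have lj: "l = j + 1 \<or> l = j - 1" by linarith
    have hil: "cork_high l (\<mu> l) \<in> C" "\<mu> l < omega1" using least[of l t] lt s by auto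
    define r where "r = (if l = j + 1 then cork_pt j (\<nu> j) (\<nu> l) else cork_pt l (\<nu> l) (\<nu> j))"
    have fr: "fst r i = (if i = j then \<nu> j else if i = l then \<nu> l else omega1)" for i
      using lj by (auto simp: r_def fst_cork_pt)
    have r: "r \<in> cork_set" "r \<noteq> cork_left" "r \<noteq> cork_right"
      unfolding r_def using \<nu>(1)[of j] \<nu>(1)[of l] by (auto intro!: cork_pt_in)
    then have "r \<in> cork_below g"
      unfolding cork_below_def using \<nu>(2) by (auto simp: fr)
    then obtain s' where s': "s' \<in> C" "r \<in> s'" using C by blast
    have "p \<in> s'" if p: "p \<in> cork_below g" "p \<notin> cork_high j (\<mu> j)" "p \<notin> cork_high l (\<mu> l)" for p
    proof -
      have pZ: "p \<in> cork_set" using p by (simp add: cork_below_def)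
      have pj: "fst p j \<le> \<nu> j" "fst p l \<le> \<nu> l"
        using out[OF p(1,2) hij(2)] out[OF p(1,3) hil(2)] by auto
      then have "fst p j < omega1" "fst p l < omega1"
        using \<nu>(1)[of j] \<nu>(1)[of l] by order+
      then have po: "fst p i = omega1" if "i \<noteq> j" "i \<noteq> l" for i
        using cork_adjacent[OF pZ, of i j] cork_adjacent[OF pZ, of i l] that lj cork_le[OF pZ, of i]
        by (auto simp: order_le_less)
      have "fst p i \<le> fst r i" for i using pj po[of i] by (simp add: fr)
      then consider "p \<in> s'" | i t where "s' = cork_high i t" "t < omega1" "t < fst r i"
        using cork_subbase_mono[of s' r p] s' C r pZ by blast
      then show ?thesis
      proof cases
        case (2 i t)
        \<comment> \<open>A \<open>cork_high\<close> at any third coordinate is harmless: the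
          remaining points have the value \<open>omega1\<close> there.\<close>
        then have "i \<noteq> j" "i \<noteq> l"
          using minimal[of i t] s' \<nu>(3)[of i] by (auto simp: fr split: if_splits)
        then show ?thesis using 2 po[of i] pZ by (auto simp: cork_high_def)
      qed
    qed
    then have "cork_below g \<subseteq> \<Union>{s', cork_high j (\<mu> j), cork_high l (\<mu> l)}" by blast
    then show ?thesis using s' hij hil
      by (intro exI[of _ "{s', cork_high j (\<mu> j), cork_high l (\<mu> l)}"]) simp
  qed
qed

text \<open>Without a \<open>cork_high\<close> in the cover, the ends lie in some
  \<open>cork_leftof k\<close> and \<open>cork_rightof m\<close>. Only the coordinates from
  \<open>k\<close> to \<open>m\<close> are left, and each costs one set: the one covering
  \<open>cork_pt j g omega1\<close>, above which no point with \<open>j\<close>-th coordinate at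
  most \<open>g\<close> can lie.\<close>

lemma compactin_cork_below:
  assumes g: "g < omega1"
  shows "compactin cork (cork_below g)"
  unfolding cork_def
proof (rule compactin_generated)
  show "cork_below g \<subseteq> \<Union>cork_subbase"
    unfolding Union_cork_subbase cork_below_def by blast
  fix C assume C: "C \<subseteq> cork_subbase" "cork_below g \<subseteq> \<Union>C"
  show "\<exists>C'. finite C' \<and> C' \<subseteq> C \<and> cork_below g \<subseteq> \<Union>C'"
  proof (cases "\<exists>j d. cork_high j d \<in> C \<and> d < omega1")
    case True
    then show ?thesis using cork_below_cover_high[OF C g] by blast
  next
    case False
    have ends: "cork_left \<in> cork_below g" "cork_right \<in> cork_below g"
      by (simp_all add: cork_below_def)
    obtain s where s: "s \<in> C" "cork_left \<in> s" using C ends by blast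
    then have "s \<in> cork_subbase" using C by blast
    then obtain k where k: "s = cork_leftof k"
      by (cases rule: cork_subbase_cases)
        (use s False g in \<open>auto simp: cork_low_def cork_rightof_def\<close>)
    obtain s' where s': "s' \<in> C" "cork_right \<in> s'" using C ends by blast
    then have "s' \<in> cork_subbase" using C by blast
    then obtain m where m: "s' = cork_rightof m"
      by (cases rule: cork_subbase_cases)
        (use s' False g in \<open>auto simp: cork_low_def cork_leftof_def\<close>)
    have "\<exists>t\<in>C. \<forall>p\<in>cork_set. fst p j \<le> g \<longrightarrow> p \<in> t" for j
    proof -
      let ?q = "cork_pt j g omega1"
      have "?q \<in> cork_below g"
        unfolding cork_below_def using g by (auto simp: fst_cork_pt intro!: cork_pt_in)
      then obtain t where t: "t \<in> C" "?q \<in> t" using C by blast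
      have "p \<in> t" if "p \<in> cork_set" "fst p j \<le> g" for p
      proof -
        have "fst p l \<le> fst ?q l" for l
          using that cork_le[OF that(1)] by (simp add: fst_cork_pt)
        then show ?thesis
          using cork_subbase_mono[of t ?q p] t C that False by fastforce
      qed
      then show ?thesis using t by blast
    qed
    then obtain t where t: "\<And>j. t j \<in> C" "\<And>j p. p \<in> cork_set \<Longrightarrow> fst p j \<le> g \<Longrightarrow> p \<in> t j"
      by metis
    have "p \<in> \<Union>({s, s'} \<union> t ` {k..m})" if "p \<in> cork_below g" for p
    proof (cases "p = cork_left \<or> p = cork_right")
      case True
      then show ?thesis using s s' by blast
    next
      case False
      have pZ: "p \<in> cork_set" using that by (simp add: cork_below_def)
      then obtain j where j: "fst p j < omega1" using False cork_support[of p] by blast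
      then have "fst p j \<le> g" using that by (auto simp: cork_below_def dest: spec[of _ j])
      then have "p \<in> t j" using t pZ by blast
      moreover have "j \<le> k \<Longrightarrow> p \<in> s" using j pZ k by (auto simp: cork_leftof_def)
      moreover have "m \<le> j \<Longrightarrow> p \<in> s'" using j pZ m by (auto simp: cork_rightof_def)
      moreover have "j \<in> {k..m} \<or> j \<le> k \<or> m \<le> j" by auto
      ultimately show ?thesis by blast
    qed
    then show ?thesis
      using s s' t(1) by (intro exI[of _ "{s, s'} \<union> t ` {k..m}"]) auto
  qed
qed

lemma countable_subset_compact_cork:
  assumes "countable A" "A \<subseteq> cork_set"
  shows "\<exists>K. compactin cork K \<and> A \<subseteq> K"
proof -
  let ?B = "(\<Union>p\<in>A. range (fst p)) - {omega1}"
  have "countable ?B" using assms by blast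
  moreover have "?B \<subseteq> {..<omega1}"
    using assms(2) cork_le by (force simp: order_le_less)
  ultimately obtain g where g: "g < omega1" "\<And>x. x \<in> ?B \<Longrightarrow> x < g"
    using bounded_omega1[of ?B] by blast
  have "A \<subseteq> cork_below g"
  proof
    fix p assume "p \<in> A"
    then have "fst p j = omega1 \<or> fst p j < g" for j using g(2)[of "fst p j"] by blast
    then show "p \<in> cork_below g"
      using assms(2) \<open>p \<in> A\<close> by (force simp: cork_below_def order_le_less)
  qed
  with compactin_cork_below[OF g(1)] show ?thesis by blast
qed

section \<open>Convergence in the corkscrew and inseparability of its ends\<close>

text \<open>Away from the ends coordinatewise convergence suffices: membership in
  \<open>cork_rightof k\<close> or \<open>cork_leftof k\<close> follows once a single coordinate
  stays below \<open>omega1\<close>.\<close>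

lemma limitin_cork:
  assumes l: "l \<in> cork_set" "l \<noteq> cork_left" "l \<noteq> cork_right"
    and ev: "eventually (\<lambda>x. f x \<in> cork_set) F"
    and low: "\<And>i g. g < omega1 \<Longrightarrow> fst l i \<le> g \<Longrightarrow> eventually (\<lambda>x. fst (f x) i \<le> g) F"
    and high: "\<And>i g. g < omega1 \<Longrightarrow> g < fst l i \<Longrightarrow> eventually (\<lambda>x. g < fst (f x) i) F"
  shows "limitin cork f l F"
  unfolding cork_def
proof (rule limitin_generated)
  show "l \<in> \<Union>cork_subbase" using l by (simp add: Union_cork_subbase)
  fix s assume "s \<in> cork_subbase" and ls: "l \<in> s"
  then show "eventually (\<lambda>x. f x \<in> s) F"
  proof (cases rule: cork_subbase_cases)
    case (low j g)
    then have "eventually (\<lambda>x. fst (f x) j \<le> g) F"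
      using ls by (intro assms(5)) (auto simp: cork_low_def)
    with ev show ?thesis by eventually_elim (auto simp: low cork_low_def)
  next
    case (high j g)
    then have "eventually (\<lambda>x. g < fst (f x) j) F"
      using ls by (intro assms(6)) (auto simp: cork_high_def)
    with ev show ?thesis by eventually_elim (auto simp: high cork_high_def)
  next
    case (right k)
    with ls l obtain j where j: "j \<ge> k" "fst l j < omega1" by (auto simp: cork_rightof_def)
    then have "eventually (\<lambda>x. fst (f x) j \<le> fst l j) F" by (intro low) auto
    with ev show ?thesis
      by eventually_elim (use j in \<open>auto simp: right cork_rightof_def intro: order_le_less_trans\<close>)
  next
    case (left k)
    with ls l obtain j where j: "j \<le> k" "fst l j < omega1" by (auto simp: cork_leftof_def)
    then have "eventually (\<lambda>x. fst (f x) j \<le> fst l j) F" by (intro low) auto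
    with ev show ?thesis
      by eventually_elim (use j in \<open>auto simp: left cork_leftof_def intro: order_le_less_trans\<close>)
  qed
qed

definition omega1_filter :: "ordw filter" where
  "omega1_filter = (INF g\<in>{..<omega1}. principal {g<..<omega1})"

lemma eventually_omega1:
  "eventually P omega1_filter \<longleftrightarrow> (\<exists>g<omega1. \<forall>x. g < x \<and> x < omega1 \<longrightarrow> P x)"
proof -
  obtain g0 where "g0 < omega1" using bounded_omega1[of "{}"] by auto
  then have "eventually P omega1_filter \<longleftrightarrow> (\<exists>g\<in>{..<omega1}. eventually P (principal {g<..<omega1}))"
    unfolding omega1_filter_def
  proof (intro eventually_INF_base)
    fix a b assume "a \<in> {..<omega1}" "b \<in> {..<omega1}"
    then show "\<exists>x\<in>{..<omega1}. principal {x<..<omega1} \<le> inf (principal {a<..<omega1}) (principal {b<..<omega1})"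
      by (intro bexI[of _ "max a b"]) auto
  qed auto
  then show ?thesis by (simp add: eventually_principal Bex_def Ball_def)
qed

lemma limitin_cork_edge:
  assumes "x < omega1"
  shows "limitin cork (\<lambda>y. cork_pt j x y) (cork_pt j x omega1) omega1_filter"
    and "limitin cork (\<lambda>y. cork_pt j y x) (cork_pt j omega1 x) omega1_filter"
proof -
  have 1: "eventually (\<lambda>y. y < omega1) omega1_filter"
    unfolding eventually_omega1 using assms by blast
  have 2: "eventually (\<lambda>y. g < y) omega1_filter" if "g < omega1" for g
    unfolding eventually_omega1 using that by blast
  have c: "g < omega1 \<Longrightarrow> \<not> omega1 \<le> g" for g by simp
  show "limitin cork (\<lambda>y. cork_pt j x y) (cork_pt j x omega1) omega1_filter"
  proof (rule limitin_cork)
    show "eventually (\<lambda>y. cork_pt j x y \<in> cork_set) omega1_filter"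
      by (rule eventually_mono[OF 1]) (use assms in \<open>auto intro!: cork_pt_in\<close>)
  qed (use assms c 2 in \<open>auto simp: fst_cork_pt intro!: cork_pt_in split: if_splits\<close>)
  show "limitin cork (\<lambda>y. cork_pt j y x) (cork_pt j omega1 x) omega1_filter"
  proof (rule limitin_cork)
    show "eventually (\<lambda>y. cork_pt j y x \<in> cork_set) omega1_filter"
      by (rule eventually_mono[OF 1]) (use assms in \<open>auto intro!: cork_pt_in\<close>)
  qed (use assms c 2 in \<open>auto simp: fst_cork_pt intro!: cork_pt_in split: if_splits\<close>)
qed

lemma limitin_cork_inner:
  assumes "\<gamma> < omega1" "\<And>n. x n \<le> \<gamma>" "\<And>n. y n \<le> \<gamma>"
    and "\<And>g. g < \<gamma> \<Longrightarrow> eventually (\<lambda>n. g < x n \<and> g < y n) sequentially"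
  shows "limitin cork (\<lambda>n. cork_pt j (x n) (y n)) (cork_pt j \<gamma> \<gamma>) sequentially"
proof (rule limitin_cork)
  have xy: "x n < omega1" "y n < omega1" for n
    using assms(1) assms(2)[of n] assms(3)[of n] by order+
  show "eventually (\<lambda>n. cork_pt j (x n) (y n) \<in> cork_set) sequentially"
    using xy by (intro always_eventually allI cork_pt_in) (auto intro: less_imp_le)
  show "cork_pt j \<gamma> \<gamma> \<in> cork_set" using assms(1) by (auto intro!: cork_pt_in)
  fix i g assume "g < omega1"
  show "eventually (\<lambda>n. fst (cork_pt j (x n) (y n)) i \<le> g) sequentially"
    if "fst (cork_pt j \<gamma> \<gamma>) i \<le> g"
    using that assms(2,3) order_trans by (fastforce simp: fst_cork_pt intro!: always_eventually)
  show "eventually (\<lambda>n. g < fst (cork_pt j (x n) (y n)) i) sequentially"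
    if "g < fst (cork_pt j \<gamma> \<gamma>) i"
  proof (cases "i = j \<or> i = j + 1")
    case True
    then have "g < \<gamma>" using that by (auto simp: fst_cork_pt split: if_splits)
    from assms(4)[OF this] show ?thesis
      by eventually_elim (use True in \<open>auto simp: fst_cork_pt\<close>)
  qed (use \<open>g < omega1\<close> in \<open>simp add: fst_cork_pt\<close>)
qed auto

lemma limitin_cork_left:
  assumes "x < omega1"
  shows "limitin cork (\<lambda>j. cork_pt j x omega1) cork_left at_bot"
  unfolding cork_def
proof (rule limitin_generated)
  show "cork_left \<in> \<Union>cork_subbase" by (simp add: Union_cork_subbase)
  fix s assume "s \<in> cork_subbase" and ls: "cork_left \<in> s"
  have Z: "cork_pt j x omega1 \<in> cork_set" for j using assms by (auto intro!: cork_pt_in)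
  from \<open>s \<in> cork_subbase\<close> show "eventually (\<lambda>j. cork_pt j x omega1 \<in> s) at_bot"
  proof (cases rule: cork_subbase_cases)
    case (low j g)
    then show ?thesis using ls by (auto simp: cork_low_def)
  next
    case (high j g)
    from eventually_le_at_bot[of "j - 1"] show ?thesis
      by eventually_elim (use Z high in \<open>auto simp: cork_high_def fst_cork_pt\<close>)
  next
    case (right k)
    then show ?thesis using ls by (auto simp: cork_rightof_def)
  next
    case (left k)
    have "eventually (\<lambda>j. j \<le> k) at_bot" by (rule eventually_le_at_bot)
    then show ?thesis
      by eventually_elim (use Z assms in \<open>auto simp: left cork_leftof_def fst_cork_pt\<close>)
  qed
qed

lemma limitin_cork_right:
  assumes "x < omega1"
  shows "limitin cork (\<lambda>j. cork_pt j x omega1) cork_right at_top"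
  unfolding cork_def
proof (rule limitin_generated)
  show "cork_right \<in> \<Union>cork_subbase" by (simp add: Union_cork_subbase)
  fix s assume "s \<in> cork_subbase" and ls: "cork_right \<in> s"
  have Z: "cork_pt j x omega1 \<in> cork_set" for j using assms by (auto intro!: cork_pt_in)
  from \<open>s \<in> cork_subbase\<close> show "eventually (\<lambda>j. cork_pt j x omega1 \<in> s) at_top"
  proof (cases rule: cork_subbase_cases)
    case (low j g)
    then show ?thesis using ls by (auto simp: cork_low_def)
  next
    case (high j g)
    from eventually_ge_at_top[of "j + 1"] show ?thesis
      by eventually_elim (use Z high in \<open>auto simp: cork_high_def fst_cork_pt\<close>)
  next
    case (left k)
    then show ?thesis using ls by (auto simp: cork_leftof_def)
  next
    case (right k)
    have "eventually (\<lambda>j. k \<le> j) at_top" by (rule eventually_ge_at_top)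
    then show ?thesis
      by eventually_elim (use Z assms in \<open>auto simp: right cork_rightof_def fst_cork_pt\<close>)
  qed
qed

lemma tendsto_continuous_map:
  assumes "continuous_map T euclideanreal \<phi>" "limitin T f l F"
  shows "((\<lambda>x. \<phi> (f x)) \<longlongrightarrow> \<phi> l) F"
  using continuous_map_limit[OF assms] by (simp add: limitin_canonical_iff o_def)

lemma omega1_sup:
  fixes g :: "nat \<Rightarrow> ordw"
  assumes "\<And>n. g n < omega1"
  obtains \<gamma> where "\<gamma> < omega1" "\<And>n. g n \<le> \<gamma>" "\<And>d. d < \<gamma> \<Longrightarrow> \<exists>n. d < g n"
proof -
  obtain b where b: "b < omega1" "\<And>n. g n < b"
    using bounded_omega1[of "range g"] assms by blast
  define \<gamma> where "\<gamma> = (LEAST d. \<forall>n. g n \<le> d)"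
  have "\<forall>n. g n \<le> \<gamma>" unfolding \<gamma>_def by (rule LeastI[of _ b]) (use b in \<open>auto simp: less_imp_le\<close>)
  moreover have "\<gamma> \<le> b" unfolding \<gamma>_def by (rule Least_le) (use b in \<open>auto simp: less_imp_le\<close>)
  moreover have "\<exists>n. d < g n" if "d < \<gamma>" for d
    using not_less_Least[of d "\<lambda>d. \<forall>n. g n \<le> d"] that unfolding \<gamma>_def by (auto simp: not_le)
  ultimately show thesis using b that by (meson order_le_less_trans)
qed

text \<open>Along points interleaved on the two edges, the values in the interior of the plank
  stay close to the edge values, while both interleavings converge to one point of the diagonal.\<close>

lemma cork_edges_close:
  assumes \<phi>: "continuous_map cork euclideanreal \<phi>" and "\<epsilon> > 0"
  shows "\<exists>g<omega1. \<forall>x y. g < x \<and> x < omega1 \<and> g < y \<and> y < omega1 \<longrightarrow>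
    \<bar>\<phi> (cork_pt j x omega1) - \<phi> (cork_pt j omega1 y)\<bar> \<le> 3 * \<epsilon>"
proof (rule ccontr)
  assume "\<not> ?thesis"
  then have bad: "\<exists>x y. g < x \<and> x < omega1 \<and> g < y \<and> y < omega1 \<and>
    3 * \<epsilon> < \<bar>\<phi> (cork_pt j x omega1) - \<phi> (cork_pt j omega1 y)\<bar>" if "g < omega1" for g
    using that by (meson not_le)
  have near: "\<exists>d<omega1. \<forall>y. d < y \<and> y < omega1 \<longrightarrow>
      \<bar>\<phi> (cork_pt j x y) - \<phi> (cork_pt j x omega1)\<bar> < \<epsilon> \<and>
      \<bar>\<phi> (cork_pt j y x) - \<phi> (cork_pt j omega1 x)\<bar> < \<epsilon>" if "x < omega1" for x
  proof -
    have "eventually (\<lambda>y. \<bar>\<phi> (cork_pt j x y) - \<phi> (cork_pt j x omega1)\<bar> < \<epsilon> \<and>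
      \<bar>\<phi> (cork_pt j y x) - \<phi> (cork_pt j omega1 x)\<bar> < \<epsilon>) omega1_filter"
      using tendstoD[OF tendsto_continuous_map[OF \<phi> limitin_cork_edge(1)[OF that, of j]] \<open>\<epsilon> > 0\<close>]
        tendstoD[OF tendsto_continuous_map[OF \<phi> limitin_cork_edge(2)[OF that, of j]] \<open>\<epsilon> > 0\<close>]
      by eventually_elim (auto simp: dist_real_def)
    then show ?thesis unfolding eventually_omega1 .
  qed
  \<comment> \<open>A bad pair \<open>x\<close>, \<open>y\<close> between \<open>g\<close> and
    \<open>h\<close>, with \<open>h\<close> so large that beyond it the interior values next to
    \<open>x\<close> and \<open>y\<close> are within \<open>\<epsilon>\<close> of the edge
    values.\<close>
  define Q where "Q g h x y \<longleftrightarrow> h < omega1 \<and> g < x \<and> x < h \<and> g < y \<and> y < h \<and>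
    3 * \<epsilon> < \<bar>\<phi> (cork_pt j x omega1) - \<phi> (cork_pt j omega1 y)\<bar> \<and>
    (\<forall>z. h < z \<and> z < omega1 \<longrightarrow> \<bar>\<phi> (cork_pt j x z) - \<phi> (cork_pt j x omega1)\<bar> < \<epsilon> \<and>
        \<bar>\<phi> (cork_pt j z y) - \<phi> (cork_pt j omega1 y)\<bar> < \<epsilon>)" for g h x y
  have step: "\<exists>h x y. Q g h x y" if g: "g < omega1" for g
  proof -
    obtain x y where xy: "g < x" "x < omega1" "g < y" "y < omega1"
      "3 * \<epsilon> < \<bar>\<phi> (cork_pt j x omega1) - \<phi> (cork_pt j omega1 y)\<bar>"
      using bad[OF g] by blast
    obtain d where d: "d < omega1" "\<And>z. d < z \<Longrightarrow> z < omega1 \<Longrightarrow>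
      \<bar>\<phi> (cork_pt j x z) - \<phi> (cork_pt j x omega1)\<bar> < \<epsilon>"
      using near[OF xy(2)] by blast
    obtain e where e: "e < omega1" "\<And>z. e < z \<Longrightarrow> z < omega1 \<Longrightarrow>
      \<bar>\<phi> (cork_pt j z y) - \<phi> (cork_pt j omega1 y)\<bar> < \<epsilon>"
      using near[OF xy(4)] by blast
    obtain h where h: "h < omega1" "\<And>u. u \<in> {x, y, d, e} \<Longrightarrow> u < h"
      using bounded_omega1[of "{x, y, d, e}"] xy(2,4) d(1) e(1) by (auto simp del: insert_iff)
    have lt: "x < h" "y < h" "d < h" "e < h" using h(2) by auto
    have "Q g h x y"
      unfolding Q_def
    proof (intro conjI allI impI; (elim conjE)?)
      fix z assume z: "h < z" "z < omega1"
      show "\<bar>\<phi> (cork_pt j x z) - \<phi> (cork_pt j x omega1)\<bar> < \<epsilon>"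
        using z lt by (intro d(2)) order+
      show "\<bar>\<phi> (cork_pt j z y) - \<phi> (cork_pt j omega1 y)\<bar> < \<epsilon>"
        using z lt by (intro e(2)) order+
    qed (use xy h(1) lt in auto)
    then show ?thesis by blast
  qed
  obtain g0 where g0: "g0 < omega1" using bounded_omega1[of "{}"] by auto
  obtain G where G: "G 0 < omega1" "\<And>n. \<exists>x y. Q (G n) (G (Suc n)) x y"
    using dependent_nat_choice[of "\<lambda>n g. g < omega1" "\<lambda>n g h. \<exists>x y. Q g h x y"] g0 step
    by (metis Q_def)
  then obtain X Y where Q: "\<And>n. Q (G n) (G (Suc n)) (X n) (Y n)" by metis
  have G1: "G n < omega1" for n
    using G(1) Q[of "n - 1"] unfolding Q_def by (cases n) auto
  have order: "G n < X n" "X n < G (Suc n)" "G n < Y n" "Y n < G (Suc n)" for n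
    using Q[of n] unfolding Q_def by auto
  then have "strict_mono G" unfolding strict_mono_Suc_iff by (meson less_trans)
  obtain \<gamma> where \<gamma>: "\<gamma> < omega1" "\<And>n. G n \<le> \<gamma>" "\<And>d. d < \<gamma> \<Longrightarrow> \<exists>n. d < G n"
    using omega1_sup[of G] G1 by blast
  have le: "X n \<le> \<gamma>" "Y n \<le> \<gamma>" for n
    using order[of n] \<gamma>(2)[of "Suc n"] by order+
  have ev: "eventually (\<lambda>n. d < X n \<and> d < Y n) sequentially" if "d < \<gamma>" for d
  proof -
    obtain n0 where "d < G n0" using \<gamma>(3)[OF \<open>d < \<gamma>\<close>] by blast
    then have "d < X n \<and> d < Y n" if "n \<ge> n0" for n
      using order[of n] strict_mono_leD[OF \<open>strict_mono G\<close> that] by (intro conjI) order+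
    then show ?thesis by (rule eventually_sequentiallyI)
  qed
  then have ev': "eventually (\<lambda>n. d < X (Suc n) \<and> d < Y (Suc n)) sequentially" if "d < \<gamma>" for d
    using that eventually_sequentially_Suc[of "\<lambda>n. d < X n \<and> d < Y n"] by blast
  have ev2: "eventually (\<lambda>n. d < X n \<and> d < Y (Suc n)) sequentially"
    "eventually (\<lambda>n. d < X (Suc n) \<and> d < Y n) sequentially" if "d < \<gamma>" for d
    using ev[OF that] ev'[OF that] by (eventually_elim, simp)+
  \<comment> \<open>Shifting one index puts the partner beyond \<open>G (Suc n)\<close>, where the
    closeness stored in \<open>Q\<close> applies: \<open>Y (Suc n)\<close> is a good height over
    \<open>X n\<close>, and \<open>X (Suc n)\<close> over \<open>Y n\<close>.\<close>
  have lim: "(\<lambda>n. \<phi> (cork_pt j (X n) (Y (Suc n)))) \<longlonglongrightarrow> \<phi> (cork_pt j \<gamma> \<gamma>)"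
    by (rule tendsto_continuous_map[OF \<phi> limitin_cork_inner]) (rule \<gamma>(1) le ev2(1); assumption?)+
  have lim': "(\<lambda>n. \<phi> (cork_pt j (X (Suc n)) (Y n))) \<longlonglongrightarrow> \<phi> (cork_pt j \<gamma> \<gamma>)"
    by (rule tendsto_continuous_map[OF \<phi> limitin_cork_inner]) (rule \<gamma>(1) le ev2(2); assumption?)+
  have "(\<lambda>n. \<phi> (cork_pt j (X n) (Y (Suc n))) - \<phi> (cork_pt j (X (Suc n)) (Y n))) \<longlonglongrightarrow> 0"
    using tendsto_diff[OF lim lim'] by simp
  from tendstoD[OF this \<open>\<epsilon> > 0\<close>] obtain n where
    n: "\<bar>\<phi> (cork_pt j (X n) (Y (Suc n))) - \<phi> (cork_pt j (X (Suc n)) (Y n))\<bar> < \<epsilon>"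
    unfolding eventually_sequentially by auto
  \<comment> \<open>Edge to interior, interior to interior, interior to edge: three errors below
    \<open>\<epsilon>\<close>, which is the origin of the bound
    \<open>3 * \<epsilon>\<close>.\<close>
  have "X (Suc n) < omega1" "Y (Suc n) < omega1"
    using order[of "Suc n"] G1[of "Suc (Suc n)"] by order+
  then have "\<bar>\<phi> (cork_pt j (X n) (Y (Suc n))) - \<phi> (cork_pt j (X n) omega1)\<bar> < \<epsilon>"
    "\<bar>\<phi> (cork_pt j (X (Suc n)) (Y n)) - \<phi> (cork_pt j omega1 (Y n))\<bar> < \<epsilon>"
    using Q[of n] order[of "Suc n"] unfolding Q_def by auto
  moreover have "3 * \<epsilon> < \<bar>\<phi> (cork_pt j (X n) omega1) - \<phi> (cork_pt j omega1 (Y n))\<bar>"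
    using Q[of n] unfolding Q_def by auto
  ultimately show False using n by linarith
qed

text \<open>There are countably many thresholds, one for each plank and each precision, so one
  \<open>x\<close> lies beyond all of them. Along \<open>cork_pt j x omega1\<close> the function is
  then exactly constant in \<open>j\<close>, and these points run to both ends.\<close>

lemma cork_ends_inseparable:
  assumes \<phi>: "continuous_map cork euclideanreal \<phi>"
  shows "\<phi> cork_left = \<phi> cork_right"
proof -
  have "\<exists>g<omega1. \<forall>x y. g < x \<and> x < omega1 \<and> g < y \<and> y < omega1 \<longrightarrow>
    \<bar>\<phi> (cork_pt j x omega1) - \<phi> (cork_pt j omega1 y)\<bar> \<le> 3 * (1 / real (Suc n))" for j n
    by (rule cork_edges_close[OF \<phi>]) simp
  then obtain g where g: "\<And>j n. g j n < omega1"
    "\<And>j n x y. g j n < x \<Longrightarrow> x < omega1 \<Longrightarrow> g j n < y \<Longrightarrow> y < omega1 \<Longrightarrow>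
      \<bar>\<phi> (cork_pt j x omega1) - \<phi> (cork_pt j omega1 y)\<bar> \<le> 3 * (1 / real (Suc n))"
    by metis
  have "\<exists>x<omega1. \<forall>u\<in>range (\<lambda>(j, n). g j n). u < x"
    by (rule bounded_omega1) (use g(1) in auto)
  then obtain x where x: "x < omega1" "\<And>u. u \<in> range (\<lambda>(j, n). g j n) \<Longrightarrow> u < x"
    by blast
  have gx: "g j n < x" for j n using x(2)[of "g j n"] by force
  have step: "\<phi> (cork_pt j x omega1) = \<phi> (cork_pt (j + 1) x omega1)" for j
  proof -
    let ?d = "\<bar>\<phi> (cork_pt j x omega1) - \<phi> (cork_pt (j + 1) x omega1)\<bar>"
    have "?d \<le> 3 * (1 / real (Suc n))" for n
      using g(2)[OF gx x(1) gx x(1), of j n] by (simp only: cork_pt_swap)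
    moreover have "(\<lambda>n. 3 * (1 / real (Suc n))) \<longlonglongrightarrow> 3 * 0"
      by (intro tendsto_intros LIMSEQ_Suc lim_1_over_n)
    ultimately have "?d \<le> 3 * 0"
      using LIMSEQ_le_const by blast
    then show ?thesis by simp
  qed
  have const: "\<phi> (cork_pt j x omega1) = \<phi> (cork_pt 0 x omega1)" for j
  proof (induction j rule: int_induct[where k = 0])
    case (step1 i)
    then show ?case using step[of i] by simp
  next
    case (step2 i)
    then show ?case using step[of "i - 1"] by simp
  qed simp
  have eq: "(\<lambda>j. \<phi> (cork_pt j x omega1)) = (\<lambda>_. \<phi> (cork_pt 0 x omega1))"
    using const by blast
  have "((\<lambda>j::int. \<phi> (cork_pt 0 x omega1)) \<longlongrightarrow> \<phi> cork_left) at_bot"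
    using tendsto_continuous_map[OF \<phi> limitin_cork_left[OF x(1)]] unfolding eq .
  moreover have "((\<lambda>j::int. \<phi> (cork_pt 0 x omega1)) \<longlongrightarrow> \<phi> cork_right) at_top"
    using tendsto_continuous_map[OF \<phi> limitin_cork_right[OF x(1)]] unfolding eq .
  ultimately have "\<phi> (cork_pt 0 x omega1) = \<phi> cork_left" "\<phi> (cork_pt 0 x omega1) = \<phi> cork_right"
    by (simp_all add: tendsto_const_iff)
  then show ?thesis by simp
qed

section \<open>The collapsed hyperspace\<close>

lemma Hausdorff_regular_T1:
  assumes "regular_T1 T"
  shows "Hausdorff_space T"
  unfolding Hausdorff_space_def
proof (intro allI impI)
  fix x y assume xy: "x \<in> topspace T \<and> y \<in> topspace T \<and> x \<noteq> y"
  have "t1_space T" using assms by (simp add: regular_T1_def)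
  then obtain U where U: "openin T U" "x \<in> U" "y \<notin> U"
    using xy unfolding t1_space_def by metis
  then obtain V where V: "openin T V" "x \<in> V" "T closure_of V \<subseteq> U"
    using assms unfolding regular_T1_def by blast
  have "openin T (topspace T - T closure_of V)" by (intro openin_diff) auto
  moreover have "y \<in> topspace T - T closure_of V" using xy U V by blast
  moreover have "disjnt V (topspace T - T closure_of V)"
    using closure_of_subset[OF openin_subset[OF V(1)]] by (auto simp: disjnt_def)
  ultimately show "\<exists>U V. openin T U \<and> openin T V \<and> x \<in> U \<and> y \<in> V \<and> disjnt U V"
    using V by blast
qed

lemma regular_T1_compact_nbhd:
  assumes "regular_T1 T" "compactin T K" "openin T U" "K \<subseteq> U"
  obtains W where "openin T W" "K \<subseteq> W" "T closure_of W \<subseteq> U"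
proof -
  have "\<forall>x\<in>K. \<exists>V. openin T V \<and> x \<in> V \<and> T closure_of V \<subseteq> U"
    using assms unfolding regular_T1_def by blast
  then obtain V where V: "\<And>x. x \<in> K \<Longrightarrow> openin T (V x)" "\<And>x. x \<in> K \<Longrightarrow> x \<in> V x"
    "\<And>x. x \<in> K \<Longrightarrow> T closure_of (V x) \<subseteq> U"
    by metis
  obtain \<F> where F: "finite \<F>" "\<F> \<subseteq> V ` K" "K \<subseteq> \<Union>\<F>"
    using compactinD[OF assms(2), of "V ` K"] V(1,2) by blast
  have "openin T (\<Union>\<F>)" using F V(1) by blast
  moreover have "T closure_of (\<Union>\<F>) \<subseteq> U"
    using F V(3) by (auto simp: closure_of_Union)
  ultimately show thesis using that F by blast
qed

locale inseparable_pair =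
  fixes Z :: "'z topology" and a b :: 'z
  assumes reg: "regular_T1 Z"
    and ab: "a \<in> topspace Z" "b \<in> topspace Z" "a \<noteq> b"
    and insep: "\<And>\<phi>. continuous_map Z euclideanreal \<phi> \<Longrightarrow> \<phi> a = \<phi> b"
    and countable_compact: "\<And>A. countable A \<Longrightarrow> A \<subseteq> topspace Z \<Longrightarrow> \<exists>K. compactin Z K \<and> A \<subseteq> K"
begin

text \<open>The compact sets containing \<open>b\<close> are collapsed to one point, represented by \<open>{b}\<close>.\<close>

definition hyp :: "'z set set" where
  "hyp = insert {b} {T. compactin Z T \<and> a \<in> T \<and> b \<notin> T}"

definition hyp_in where "hyp_in V = {T \<in> hyp. T \<subseteq> V}"
definition hyp_meet where "hyp_meet U = {T \<in> hyp. T \<inter> U \<noteq> {}}"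

text \<open>The Vietoris subbase without the sets \<open>hyp_in V\<close> for \<open>V\<close>
  containing \<open>b\<close>. The collapsed point stands for all compact sets through
  \<open>b\<close>, however large, so its neighbourhoods may only demand that a set meets a
  neighbourhood of \<open>b\<close>. Under the map of \<open>hyp_line\<close> such a
  \<open>hyp_in V\<close> would pull back to \<open>{b}\<close> whenever \<open>T\<close> is not
  inside \<open>V\<close>.\<close>

definition hyp_subbase where
  "hyp_subbase = {hyp_in V | V. openin Z V \<and> b \<notin> V} \<union> {hyp_meet U | U. openin Z U}"

definition hyptop where "hyptop = topology_generated_by hyp_subbase"

lemma Hausdorff: "Hausdorff_space Z"
  using reg by (rule Hausdorff_regular_T1)

lemma compactin_hyp: "T \<in> hyp \<Longrightarrow> compactin Z T"
  using ab by (auto simp: hyp_def)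

lemma hyp_subset: "T \<in> hyp \<Longrightarrow> T \<subseteq> topspace Z"
  using compactin_hyp compactin_subset_topspace by blast

lemma hyp_b: "T \<in> hyp \<Longrightarrow> b \<in> T \<Longrightarrow> T = {b}"
  by (auto simp: hyp_def)

lemma hyp_a: "T \<in> hyp \<Longrightarrow> b \<notin> T \<Longrightarrow> a \<in> T"
  by (auto simp: hyp_def)

lemma b_in_hyp: "{b} \<in> hyp" by (simp add: hyp_def)

lemma hyp_nonempty: "T \<in> hyp \<Longrightarrow> T \<noteq> {}"
  by (auto simp: hyp_def)

lemma hyp_meet_topspace: "hyp_meet (topspace Z) = hyp"
  unfolding hyp_meet_def using hyp_subset hyp_nonempty by blast

lemma Union_hyp_subbase: "\<Union>hyp_subbase = hyp"
proof -
  have "hyp_meet (topspace Z) \<in> hyp_subbase" by (auto simp: hyp_subbase_def)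
  moreover have "s \<subseteq> hyp" if "s \<in> hyp_subbase" for s
    using that by (auto simp: hyp_subbase_def hyp_in_def hyp_meet_def)
  ultimately show ?thesis unfolding hyp_meet_topspace by blast
qed

lemma topspace_hyptop [simp]: "topspace hyptop = hyp"
  by (simp add: hyptop_def Union_hyp_subbase)

lemma openin_hyp_in: "openin Z V \<Longrightarrow> b \<notin> V \<Longrightarrow> openin hyptop (hyp_in V)"
  unfolding hyptop_def by (intro topology_generated_by_Basis) (auto simp: hyp_subbase_def)

lemma openin_hyp_meet: "openin Z U \<Longrightarrow> openin hyptop (hyp_meet U)"
  unfolding hyptop_def by (intro topology_generated_by_Basis) (auto simp: hyp_subbase_def)

lemma closedin_hyp_meet_closed:
  assumes "closedin Z C" "b \<in> C"
  shows "closedin hyptop {T \<in> hyp. T \<inter> C \<noteq> {}}"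
proof -
  have "hyp - {T \<in> hyp. T \<inter> C \<noteq> {}} = hyp_in (topspace Z - C)"
    using hyp_subset by (auto simp: hyp_in_def)
  moreover have "openin hyptop (hyp_in (topspace Z - C))"
    using assms by (intro openin_hyp_in) auto
  ultimately show ?thesis unfolding closedin_def by auto
qed

lemma closedin_hyp_in_closed:
  assumes "closedin Z C"
  shows "closedin hyptop {T \<in> hyp. T \<subseteq> C}"
proof -
  have "hyp - {T \<in> hyp. T \<subseteq> C} = hyp_meet (topspace Z - C)"
    using hyp_subset by (auto simp: hyp_meet_def)
  moreover have "openin hyptop (hyp_meet (topspace Z - C))"
    using assms by (intro openin_hyp_meet) auto
  ultimately show ?thesis unfolding closedin_def by auto
qed

text \<open>If \<open>b\<close> is not in \<open>C\<close>, members meeting \<open>C\<close> may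
  accumulate at \<open>{b}\<close>. Confining them to a closed \<open>E\<close> off \<open>b\<close>
  prevents this, because \<open>{b}\<close> then lies in the open set of members meeting the
  complement of \<open>E\<close>.\<close>

lemma closedin_hyp_in_meet_closed:
  assumes "closedin Z C" "closedin Z E" "b \<notin> E"
  shows "closedin hyptop {T \<in> hyp. T \<inter> C \<noteq> {} \<and> T \<subseteq> E}"
proof -
  have Zb: "closedin Z {b}" using Hausdorff ab by (simp add: closedin_Hausdorff_sing_eq)
  have "hyp - {T \<in> hyp. T \<inter> C \<noteq> {} \<and> T \<subseteq> E} =
      hyp_in (topspace Z - (C \<union> {b})) \<union> hyp_meet (topspace Z - E)" (is "?L = ?R")
  proof (rule Set.set_eqI)
    fix T
    show "T \<in> ?L \<longleftrightarrow> T \<in> ?R"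
    proof (cases "T \<in> hyp")
      case True
      then show ?thesis
        using hyp_b[of T] hyp_subset[of T] assms(3) by (auto simp: hyp_in_def hyp_meet_def)
    qed (simp add: hyp_in_def hyp_meet_def)
  qed
  moreover have "openin hyptop (hyp_in (topspace Z - (C \<union> {b})))"
    by (intro openin_hyp_in openin_diff openin_topspace closedin_Un assms Zb) auto
  moreover have "openin hyptop (hyp_meet (topspace Z - E))"
    using assms by (intro openin_hyp_meet) auto
  ultimately show ?thesis unfolding closedin_def by auto
qed

lemma hyp_subbase_nbhd:
  assumes "s \<in> hyp_subbase" "T \<in> s"
  shows "\<exists>V K. openin hyptop V \<and> closedin hyptop K \<and> T \<in> V \<and> V \<subseteq> K \<and> K \<subseteq> s"
proof -
  have T: "T \<in> hyp" using assms Union_hyp_subbase by blast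
  have cl: "W \<subseteq> Z closure_of W" if "openin Z W" for W
    using that by (meson closure_of_subset openin_subset)
  consider (i) V where "s = hyp_in V" "openin Z V" "b \<notin> V" | (m) U where "s = hyp_meet U" "openin Z U"
    using assms(1) unfolding hyp_subbase_def by blast
  then show ?thesis
  proof cases
    case i
    then have "T \<subseteq> V" using assms(2) by (simp add: hyp_in_def)
    then obtain W where W: "openin Z W" "T \<subseteq> W" "Z closure_of W \<subseteq> V"
      using regular_T1_compact_nbhd[OF reg compactin_hyp[OF T] i(2)] by blast
    have "b \<notin> W" using W cl[of W] i by blast
    show ?thesis
    proof (intro exI conjI)
      show "openin hyptop (hyp_in W)" using W \<open>b \<notin> W\<close> by (intro openin_hyp_in)
      show "closedin hyptop {T \<in> hyp. T \<subseteq> Z closure_of W}" by (rule closedin_hyp_in_closed) simp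
      show "T \<in> hyp_in W" using T W by (simp add: hyp_in_def)
      show "hyp_in W \<subseteq> {T \<in> hyp. T \<subseteq> Z closure_of W}"
        using cl[OF W(1)] by (auto simp: hyp_in_def)
      show "{T \<in> hyp. T \<subseteq> Z closure_of W} \<subseteq> s"
        using W(3) by (auto simp: hyp_in_def i)
    qed
  next
    case m
    then obtain t where t: "t \<in> T" "t \<in> U" using assms(2) by (auto simp: hyp_meet_def)
    obtain W where W: "openin Z W" "t \<in> W" "Z closure_of W \<subseteq> U"
      using reg m(2) t unfolding regular_T1_def by blast
    show ?thesis
    proof (cases "b \<in> T")
      case True
      then have "t = b" using hyp_b[OF T] t by blast
      show ?thesis
      proof (intro exI conjI)
        show "openin hyptop (hyp_meet W)" using W by (intro openin_hyp_meet)
        show "closedin hyptop {T \<in> hyp. T \<inter> Z closure_of W \<noteq> {}}"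
          using W cl[of W] \<open>t = b\<close> by (intro closedin_hyp_meet_closed) auto
        show "T \<in> hyp_meet W" using T W t by (auto simp: hyp_meet_def)
        show "hyp_meet W \<subseteq> {T \<in> hyp. T \<inter> Z closure_of W \<noteq> {}}"
          using cl[OF W(1)] by (auto simp: hyp_meet_def)
        show "{T \<in> hyp. T \<inter> Z closure_of W \<noteq> {}} \<subseteq> s"
          using W(3) by (auto simp: hyp_meet_def m)
      qed
    next
      case False
      have "openin Z (topspace Z - {b})"
        using Hausdorff ab by (intro openin_diff) (auto simp: closedin_Hausdorff_sing_eq)
      then obtain V where V: "openin Z V" "T \<subseteq> V" "Z closure_of V \<subseteq> topspace Z - {b}"
        using regular_T1_compact_nbhd[OF reg compactin_hyp[OF T], of "topspace Z - {b}"]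
          False hyp_subset[OF T] by blast
      have "b \<notin> V" using V cl[of V] by blast
      show ?thesis
      proof (intro exI conjI)
        show "openin hyptop (hyp_in V \<inter> hyp_meet W)"
          using W V \<open>b \<notin> V\<close> by (intro openin_Int openin_hyp_meet openin_hyp_in)
        show "closedin hyptop {T \<in> hyp. T \<inter> Z closure_of W \<noteq> {} \<and> T \<subseteq> Z closure_of V}"
          using V by (intro closedin_hyp_in_meet_closed) auto
        show "T \<in> hyp_in V \<inter> hyp_meet W" using T W V t by (auto simp: hyp_meet_def hyp_in_def)
        show "hyp_in V \<inter> hyp_meet W \<subseteq> {T \<in> hyp. T \<inter> Z closure_of W \<noteq> {} \<and> T \<subseteq> Z closure_of V}"
          using cl[OF W(1)] cl[OF V(1)] by (auto simp: hyp_meet_def hyp_in_def)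
        show "{T \<in> hyp. T \<inter> Z closure_of W \<noteq> {} \<and> T \<subseteq> Z closure_of V} \<subseteq> s"
          using W(3) by (auto simp: hyp_meet_def m)
      qed
    qed
  qed
qed

lemma regular_T1_hyptop: "regular_T1 hyptop"
  unfolding hyptop_def
proof (rule regular_T1_generated)
  fix T S assume TS: "T \<in> \<Union>hyp_subbase" "S \<in> \<Union>hyp_subbase" "T \<noteq> S"
  then have h: "T \<in> hyp" "S \<in> hyp" by (simp_all add: Union_hyp_subbase)
  have "\<exists>U. openin hyptop U \<and> T \<in> U \<and> S \<notin> U"
  proof (cases "T \<subseteq> S")
    case False
    have "closedin Z S" using compactin_hyp[OF h(2)] Hausdorff by (rule compactin_imp_closedin[rotated])
    then have "openin hyptop (hyp_meet (topspace Z - S))" by (intro openin_hyp_meet) auto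
    moreover have "T \<in> hyp_meet (topspace Z - S)" "S \<notin> hyp_meet (topspace Z - S)"
      using False h hyp_subset[of T] by (auto simp: hyp_meet_def)
    ultimately show ?thesis by blast
  next
    case True
    with TS(3) obtain s where s: "s \<in> S" "s \<notin> T" by blast
    have "b \<notin> T" using True TS(3) hyp_b h by blast
    have "closedin Z {s, b}"
      using Hausdorff ab s hyp_subset[OF h(2)]
      by (intro compactin_imp_closedin finite_imp_compactin) auto
    then have "openin hyptop (hyp_in (topspace Z - {s, b}))" by (intro openin_hyp_in) auto
    moreover have "T \<in> hyp_in (topspace Z - {s, b})" "S \<notin> hyp_in (topspace Z - {s, b})"
      using s \<open>b \<notin> T\<close> h hyp_subset[of T] by (auto simp: hyp_in_def)
    ultimately show ?thesis by blast
  qed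
  then show "\<exists>U. openin (topology_generated_by hyp_subbase) U \<and> T \<in> U \<and> S \<notin> U"
    unfolding hyptop_def .
qed (use hyp_subbase_nbhd in \<open>unfold hyptop_def, blast\<close>)

lemma hyp_line:
  assumes T: "T \<in> hyp" "b \<notin> T"
  shows "continuous_map Z hyptop (\<lambda>z. if z = b then {b} else insert z T)"
  unfolding hyptop_def
proof (rule continuous_on_generated_topo)
  let ?f = "\<lambda>z. if z = b then {b} else insert z T"
  have cT: "compactin Z T" "a \<in> T" using T by (auto simp: hyp_def)
  have "compactin Z (insert z T)" if "z \<in> topspace Z" for z
    using compactin_Un[of Z "{z}" T] that cT by (simp add: finite_imp_compactin)
  then have f: "?f z \<in> hyp" if "z \<in> topspace Z" for z
    using that cT T by (auto simp: hyp_def)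
  then have f': "insert z T \<in> hyp" if "z \<in> topspace Z" "z \<noteq> b" for z
    using that by (metis (full_types))
  show "?f ` topspace Z \<subseteq> \<Union>hyp_subbase"
    using f unfolding Union_hyp_subbase by (rule image_subsetI)
  have opb: "openin Z (topspace Z - {b})"
    using Hausdorff ab by (intro openin_diff) (auto simp: closedin_Hausdorff_sing_eq)
  fix s assume "s \<in> hyp_subbase"
  then consider (i) V where "s = hyp_in V" "openin Z V" "b \<notin> V" | (m) U where "s = hyp_meet U" "openin Z U"
    unfolding hyp_subbase_def by blast
  then show "openin Z (?f -` s \<inter> topspace Z)"
  proof cases
    case i
    have "?f -` s \<inter> topspace Z = (if T \<subseteq> V then V else {})"
      using i f' b_in_hyp openin_subset[OF i(2)] by (auto simp: hyp_in_def split: if_splits)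
    then show ?thesis using i by simp
  next
    case m
    have "?f -` s \<inter> topspace Z = (if T \<inter> U = {} then U else if b \<in> U then topspace Z else topspace Z - {b})"
      using m f' b_in_hyp openin_subset[OF m(2)] by (auto simp: hyp_meet_def split: if_splits)
    then show ?thesis using m opb by simp
  qed
qed

lemma R_rigid_hyptop: "R_rigid hyptop"
  unfolding R_rigid_def
proof (intro allI impI)
  fix \<phi> assume \<phi>: "continuous_map hyptop euclideanreal \<phi>"
  have "\<phi> T = \<phi> {b}" if T: "T \<in> hyp" for T
  proof (cases "b \<in> T")
    case True
    then show ?thesis using hyp_b[OF T] by simp
  next
    case False
    have "continuous_map Z euclideanreal (\<phi> \<circ> (\<lambda>z. if z = b then {b} else insert z T))"
      using hyp_line[OF T False] \<phi> by (rule continuous_map_compose)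
    from insep[OF this] show ?thesis
      using ab hyp_a[OF T False] by (simp add: insert_absorb)
  qed
  then show "\<exists>c. \<forall>x\<in>topspace hyptop. \<phi> x = c" by auto
qed

text \<open>For each subbasic neighbourhood of \<open>T\<close> there is one point of
  \<open>T\<close> such that every smaller member containing it stays in that neighbourhood.
  Finitely many such points, together with \<open>a\<close>, form a finite member.\<close>

lemma hyp_finite_dense:
  assumes "openin hyptop U" "U \<noteq> {}"
  shows "\<exists>T\<in>U. finite T"
proof -
  obtain T where T: "T \<in> U" using assms by blast
  then have h: "T \<in> hyp" using openin_subset[OF assms(1)] by auto
  show ?thesis
  proof (cases "b \<in> T")
    case True
    then show ?thesis using hyp_b[OF h] T by auto
  next
    case False
    obtain F where F: "finite F" "F \<subseteq> hyp_subbase" "T \<in> \<Inter>F" "\<Inter>F \<subseteq> U"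
      by (rule generated_nbhd[OF assms(1)[unfolded hyptop_def] T])
    have "\<exists>t\<in>T. \<forall>S\<in>hyp. t \<in> S \<longrightarrow> S \<subseteq> T \<longrightarrow> S \<in> s" if s: "s \<in> F" for s
    proof -
      have Ts: "T \<in> s" using F s by blast
      consider (i) V where "s = hyp_in V" | (m) U where "s = hyp_meet U"
        using F s unfolding hyp_subbase_def by blast
      then show ?thesis
      proof cases
        case i
        \<comment> \<open>Sets \<open>hyp_in V\<close> are closed under shrinking, so
          \<open>a\<close> serves as a dummy witness.\<close>
        then show ?thesis using Ts hyp_a[OF h False] by (intro bexI[of _ a]) (auto simp: hyp_in_def)
      next
        case m
        then obtain t where "t \<in> T" "t \<in> U" using Ts by (auto simp: hyp_meet_def)
        then show ?thesis by (intro bexI[of _ t]) (auto simp: hyp_meet_def m)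
      qed
    qed
    then obtain t where t: "\<And>s. s \<in> F \<Longrightarrow> t s \<in> T"
      "\<And>s S. s \<in> F \<Longrightarrow> S \<in> hyp \<Longrightarrow> t s \<in> S \<Longrightarrow> S \<subseteq> T \<Longrightarrow> S \<in> s"
      by metis
    let ?S = "insert a (t ` F)"
    have "?S \<subseteq> T" using t(1) hyp_a[OF h False] by auto
    moreover have fin: "finite ?S" using F by simp
    ultimately have "?S \<in> hyp"
      using False hyp_subset[OF h] by (auto simp: hyp_def intro!: finite_imp_compactin)
    then have "?S \<in> \<Inter>F" using t(2) \<open>?S \<subseteq> T\<close> by blast
    then show ?thesis using F fin by blast
  qed
qed

text \<open>The points of \<open>K\<close> outside every \<open>U\<close> with
  \<open>hyp_meet U\<close> in the cover form the largest candidate that those sets miss. If it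
  contains \<open>a\<close> it is a member, hence covered by some \<open>hyp_in V\<close>, and
  compactness of \<open>K\<close> applies to \<open>V\<close> together with the sets
  \<open>U\<close>. If \<open>a\<close> is in some \<open>U\<close>, two sets suffice, since every
  member contains \<open>a\<close> or \<open>b\<close>.\<close>

lemma compactin_hyp_subsets:
  assumes K: "compactin Z K" "a \<in> K" "b \<in> K"
  shows "compactin hyptop {T \<in> hyp. T \<subseteq> K}"
  unfolding hyptop_def
proof (rule compactin_generated)
  show "{T \<in> hyp. T \<subseteq> K} \<subseteq> \<Union>hyp_subbase" by (auto simp: Union_hyp_subbase)
  fix C assume C: "C \<subseteq> hyp_subbase" "{T \<in> hyp. T \<subseteq> K} \<subseteq> \<Union>C"
  define \<U> where "\<U> = {U. openin Z U \<and> hyp_meet U \<in> C}"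
  \<comment> \<open>No \<open>hyp_in V\<close> of the subbase contains \<open>{b}\<close>, so the
    cover must use a \<open>hyp_meet\<close> of a neighbourhood of \<open>b\<close>.\<close>
  have "{b} \<in> \<Union>C" using C K b_in_hyp by blast
  then obtain s where s: "s \<in> C" "{b} \<in> s" by blast
  then have "s \<in> hyp_subbase" using C by blast
  then obtain U0 where U0: "U0 \<in> \<U>" "b \<in> U0"
    using s unfolding hyp_subbase_def \<U>_def by (auto simp: hyp_in_def hyp_meet_def)
  have op: "\<And>U. U \<in> \<U> \<Longrightarrow> openin Z U" by (simp add: \<U>_def)
  show "\<exists>C'. finite C' \<and> C' \<subseteq> C \<and> {T \<in> hyp. T \<subseteq> K} \<subseteq> \<Union>C'"
  proof (cases "a \<in> \<Union>\<U>")
    case True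
    then obtain U1 where U1: "U1 \<in> \<U>" "a \<in> U1" by blast
    have "T \<in> hyp_meet U0 \<union> hyp_meet U1" if "T \<in> hyp" for T
      using that U0(2) U1(2) hyp_a[OF that] by (cases "b \<in> T") (auto simp: hyp_meet_def)
    then show ?thesis using U0 U1
      by (intro exI[of _ "{hyp_meet U0, hyp_meet U1}"]) (auto simp: \<U>_def)
  next
    case False
    let ?T = "K - \<Union>\<U>"
    have "openin Z (\<Union>\<U>)" using op by blast
    then have "compactin Z ?T"
      using closed_compactin[OF K(1), of ?T] compactin_imp_closedin[OF Hausdorff K(1)] by blast
    then have "?T \<in> hyp" using False K U0 by (auto simp: hyp_def)
    then obtain s1 where s1: "s1 \<in> C" "?T \<in> s1" using C by blast
    then have "s1 \<in> hyp_subbase" using C by blast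
    then consider V where "s1 = hyp_in V" "openin Z V" "b \<notin> V" | U where "s1 = hyp_meet U" "openin Z U"
      unfolding hyp_subbase_def by blast
    then obtain V where V: "s1 = hyp_in V" "openin Z V" "?T \<subseteq> V"
      using s1 by (cases; fastforce simp: hyp_meet_def hyp_in_def \<U>_def)
    have "\<exists>F. finite F \<and> F \<subseteq> insert V \<U> \<and> K \<subseteq> \<Union>F"
      by (rule compactinD[OF K(1)]) (use op V in auto)
    then obtain F where F: "finite F" "F \<subseteq> insert V \<U>" "K \<subseteq> \<Union>F" by blast
    have "T \<in> \<Union>(insert s1 (hyp_meet ` (F - {V})))" if T: "T \<in> hyp" "T \<subseteq> K" for T
    proof (cases "T \<subseteq> V")
      case True
      then show ?thesis using T V by (auto simp: hyp_in_def)
    next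
      case False
      then obtain t where t: "t \<in> T" "t \<notin> V" by blast
      then obtain U where "U \<in> F" "t \<in> U" using T F by blast
      then have "T \<in> hyp_meet U" "U \<in> F - {V}" using t T by (auto simp: hyp_meet_def)
      then show ?thesis by blast
    qed
    then show ?thesis using F s1
      by (intro exI[of _ "insert s1 (hyp_meet ` (F - {V}))"]) (auto simp: \<U>_def)
  qed
qed

lemma countable_finite_hyp_compact:
  assumes "countable A" "A \<subseteq> {T \<in> hyp. finite T}"
  shows "\<exists>K. compactin hyptop K \<and> A \<subseteq> K"
proof -
  have "countable (\<Union>T\<in>A. T)"
    using assms by (intro countable_UN) (auto intro: countable_finite)
  then have "countable (insert a (insert b (\<Union>A)))" by simp
  moreover have "insert a (insert b (\<Union>A)) \<subseteq> topspace Z"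
    using ab assms hyp_subset by blast
  ultimately obtain K where K: "compactin Z K" "insert a (insert b (\<Union>A)) \<subseteq> K"
    using countable_compact by blast
  then have "compactin hyptop {T \<in> hyp. T \<subseteq> K}" by (intro compactin_hyp_subsets) auto
  then show ?thesis using K assms by (intro exI[of _ "{T \<in> hyp. T \<subseteq> K}"]) auto
qed

lemma a_in_hyp: "{a} \<in> hyp"
  using ab by (auto simp: hyp_def)

end

section \<open>Korovin maps and their orbits\<close>

definition sd :: "'i set \<Rightarrow> 'i set \<Rightarrow> 'i set" where
  "sd A B = (A - B) \<union> (B - A)"

text \<open>An index \<open>i\<close> codes a sequence of countable sets \<open>c i n\<close> with prescribed values \<open>v i n\<close>, so that
  \<open>{i}\<close> realises these values. An index is recovered from \<open>insert i (c i n)\<close> as the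
  only element that has all the others in its code without lying in theirs; each sequence has
  uncountably many codes, the value \<open>k i 0\<close> being free, so a fresh one is always available.\<close>

lemma korovin_map_exists:
  fixes J :: "(nat \<Rightarrow> 'i) \<Rightarrow> 'i" and \<xi> :: "'i \<Rightarrow> 'x"
  assumes "inj J" and unc: "uncountable (UNIV :: 'i set)"
  shows "\<exists>f :: 'i set \<Rightarrow> 'x. (\<forall>g. f g \<in> range \<xi>) \<and>
    (\<forall>C t. countable C \<longrightarrow> (\<forall>c\<in>C. countable c) \<longrightarrow> t ` C \<subseteq> range \<xi> \<longrightarrow>
      (\<exists>g. countable g \<and> (\<forall>h\<in>C. f (sd g h) = t h)))"
proof -
  define k where "k = inv_into UNIV J"
  have kJ: "k (J u) = u" for u using \<open>inj J\<close> by (simp add: k_def)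
  \<comment> \<open>Slot 0 of the sequence \<open>k i\<close> holds the free mark, slot
    \<open>2 * n + 1\<close> the \<open>n\<close>-th value, and the remaining even slots enumerate
    the sets \<open>c i n\<close>. Removing the mark allows \<open>c i n\<close> to be empty, with
    the mark itself as filler.\<close>
  define c where "c i n = range (\<lambda>m. k i (2 * prod_encode (n, m) + 2)) - {k i 0}" for i n
  define v where "v i n = \<xi> (k i (2 * n + 1))" for i n
  define U where "U i = (\<Union>n. c i n)" for i
  define code where "code g p \<longleftrightarrow> fst p \<in> g \<and> (\<forall>j\<in>g - {fst p}. j \<in> U (fst p) \<and> fst p \<notin> U j)
    \<and> g - {fst p} = c (fst p) (snd p)" for g and p :: "'i \<times> nat"
  define f where "f g = (let p = SOME p. code g p in v (fst p) (snd p))" for g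
  have cU: "countable (U i)" for i by (auto simp: U_def c_def)
  have ext: "\<exists>g. countable g \<and> (\<forall>h\<in>C. f (sd g h) = t h)"
    if C: "countable C" "\<forall>c\<in>C. countable c" "t ` C \<subseteq> range \<xi>" for C and t :: "'i set \<Rightarrow> 'x"
  proof (cases "C = {}")
    case True
    then show ?thesis by (intro exI[of _ "{}"]) simp
  next
    case False
    define e where "e = from_nat_into C"
    have e: "range e = C" using False C by (simp add: e_def range_from_nat_into)
    have eC: "e n \<in> C" for n using e by blast
    have "\<forall>n. \<exists>i. \<xi> i = t (e n)" using C(3) eC by (metis image_subset_iff rangeE)
    then obtain r where r: "\<And>n. \<xi> (r n) = t (e n)" by metis
    define u where "u d l = (if l = 0 then d else if odd l then r (l div 2) else
      (let (n, m) = prod_decode (l div 2 - 1) in if e n = {} then d else from_nat_into (e n) m))"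
      for d and l :: nat
    define B where "B = \<Union>C \<union> (\<Union>j\<in>\<Union>C. U j)"
    have "countable (\<Union>c\<in>C. c)" using C by (intro countable_UN) auto
    then have cB: "countable (\<Union>C)" by simp
    have cB: "countable (\<Union>C)" "countable B"
      unfolding B_def by (intro cB cU countable_Un countable_UN)+
    have "inj (\<lambda>d. J (u d))"
    proof (rule injI)
      fix d d' assume "J (u d) = J (u d')"
      then have "u d 0 = u d' 0" using \<open>inj J\<close> by (simp add: inj_eq)
      then show "d = d'" by (simp add: u_def)
    qed
    then have "inj_on (\<lambda>d. J (u d)) (- \<Union>C)" by (rule inj_on_subset) simp
    moreover have "uncountable (- \<Union>C)"
      using unc cB(1) uncountable_minus_countable[of UNIV "\<Union>C"] by (simp add: Compl_eq_Diff_UNIV)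
    ultimately have "uncountable ((\<lambda>d. J (u d)) ` (- \<Union>C))"
      using countable_image_inj_on by blast
    \<comment> \<open>Distinct marks give distinct codes, so some code avoids the countable set
      \<open>B\<close>: it is in no member of \<open>C\<close> and in no code of an element of one.
      The mark is taken outside all members of \<open>C\<close>, so that removing it damages none of
      them.\<close>
    then have "\<not> (\<lambda>d. J (u d)) ` (- \<Union>C) \<subseteq> B"
      using cB(2) countable_subset by blast
    then obtain d where d: "d \<notin> \<Union>C" "J (u d) \<notin> B" by blast
    define i where "i = J (u d)"
    have ki: "k i = u d" by (simp add: i_def kJ)
    have ce: "c i n = e n" for n
    proof -
      have "u d (2 * prod_encode (n, m) + 2) = (if e n = {} then d else from_nat_into (e n) m)" for m
        by (simp add: u_def)
      moreover have "u d 0 = d" by (simp add: u_def)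
      moreover have "range (from_nat_into (e n)) = e n" if "e n \<noteq> {}"
        using that C eC by (simp add: range_from_nat_into)
      moreover have "d \<notin> e n" using d eC by blast
      ultimately show ?thesis unfolding c_def ki by (cases "e n = {}") auto
    qed
    have ve: "v i n = t (e n)" for n
      unfolding v_def ki by (simp add: u_def r)
    have Ui: "U i = \<Union>C" unfolding U_def ce using e by blast
    have iB: "i \<notin> \<Union>C" "\<And>j. j \<in> \<Union>C \<Longrightarrow> i \<notin> U j" using d(2) by (auto simp: i_def B_def)
    have "f (sd {i} h) = t h" if h: "h \<in> C" for h
    proof -
      have ih: "i \<notin> h" using iB h by blast
      then have sd: "sd {i} h = insert i h" "insert i h - {i} = h" by (auto simp: sd_def)
      obtain n where n: "h = e n" using e h by blast
      have "code (insert i h) (i, n)"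
        unfolding code_def fst_conv snd_conv sd ce using n h iB(2) by (auto simp: Ui)
      then have "code (insert i h) (SOME p. code (insert i h) p)" by (rule someI)
      then obtain i' n' where p: "(SOME p. code (insert i h) p) = (i', n')" "code (insert i h) (i', n')"
        by (metis surj_pair)
      have "i' = i"
      proof (rule ccontr)
        assume "i' \<noteq> i"
        then have "i' \<in> h" "i \<in> U i'" using p(2) by (auto simp: code_def)
        then show False using iB(2) h by blast
      qed
      \<comment> \<open>The position \<open>n'\<close> may differ from \<open>n\<close> when
        \<open>e\<close> repeats, but the stored value depends only on the set
        \<open>h\<close>.\<close>
      then have "h = e n'" using p(2) sd by (simp add: code_def ce)
      then show ?thesis unfolding sd f_def p(1) using \<open>i' = i\<close> by (simp add: ve)
    qed
    then show ?thesis by (intro exI[of _ "{i}"]) simp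
  qed
  have "f g \<in> range \<xi>" for g by (simp add: f_def v_def Let_def)
  with ext show ?thesis by (intro exI[of _ f]) blast
qed

section \<open>The Boolean group of countable sets\<close>

lemma sd_assoc: "sd (sd A B) C = sd A (sd B C)"
  and sd_commute: "sd A B = sd B A"
  and sd_self [simp]: "sd A A = {}"
  and sd_empty [simp]: "sd A {} = A" "sd {} A = A"
  by (auto simp: sd_def)

lemma countable_sd [simp]: "countable A \<Longrightarrow> countable B \<Longrightarrow> countable (sd A B)"
  by (simp add: sd_def)

definition sd_group :: "'i set monoid" where
  "sd_group = \<lparr>carrier = Collect countable, mult = sd, one = {}\<rparr>"

lemma sd_group_simps [simp]:
  "carrier sd_group = Collect countable" "mult sd_group = sd" "one sd_group = {}"
  by (simp_all add: sd_group_def)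

lemma group_sd_group: "group sd_group"
proof (rule groupI)
  fix x :: "'a set" assume "x \<in> carrier sd_group"
  then show "\<exists>y\<in>carrier sd_group. y \<otimes>\<^bsub>sd_group\<^esub> x = \<one>\<^bsub>sd_group\<^esub>"
    by (intro bexI[of _ x]) simp_all
qed (simp_all add: sd_assoc)

lemma inv_sd_group: "countable x \<Longrightarrow> inv\<^bsub>sd_group\<^esub> x = x"
  using group.inv_equality[OF group_sd_group, of x x] by simp

lemma compactin_sequence_cluster:
  fixes r :: "nat \<Rightarrow> 'a"
  assumes "compactin P S" "range r \<subseteq> S"
  shows "\<exists>x\<in>S. \<forall>V. openin P V \<and> x \<in> V \<longrightarrow> infinite {n. r n \<in> V}"
proof (rule ccontr)
  assume "\<not> ?thesis"
  then have "\<forall>x\<in>S. \<exists>V. openin P V \<and> x \<in> V \<and> finite {n. r n \<in> V}" by blast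
  then obtain V where V: "\<And>x. x \<in> S \<Longrightarrow> openin P (V x)" "\<And>x. x \<in> S \<Longrightarrow> x \<in> V x"
    "\<And>x. x \<in> S \<Longrightarrow> finite {n. r n \<in> V x}"
    by metis
  have "\<exists>\<F>. finite \<F> \<and> \<F> \<subseteq> V ` S \<and> S \<subseteq> \<Union>\<F>"
    by (rule compactinD[OF assms(1)]) (use V in auto)
  then obtain \<F> where F: "finite \<F>" "\<F> \<subseteq> V ` S" "S \<subseteq> \<Union>\<F>" by blast
  then have "UNIV \<subseteq> (\<Union>W\<in>\<F>. {n. r n \<in> W})" using assms(2) by blast
  moreover have "finite (\<Union>W\<in>\<F>. {n. r n \<in> W})"
    using F V(3) by (intro finite_UN_I) auto
  ultimately show False by (metis finite_subset infinite_UNIV_nat)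
qed

text \<open>\<open>D\<close> will be the set of finite members of the hyperspace.
  \<open>f_ext\<close> says that the projection of the orbit to any countable set of coordinates is
  onto, so the group can stand in for the full product in countable arguments.\<close>

locale korovin =
  fixes X :: "'x topology" and D :: "'x set" and f :: "'i set \<Rightarrow> 'x" and x0 x1 :: 'x
  assumes reg: "regular_T1 X" and rigid: "R_rigid X"
    and D: "D \<subseteq> topspace X" and dense: "\<And>U. openin X U \<Longrightarrow> U \<noteq> {} \<Longrightarrow> \<exists>d\<in>D. d \<in> U"
    and countable_compact: "\<And>A. countable A \<Longrightarrow> A \<subseteq> D \<Longrightarrow> \<exists>K. compactin X K \<and> A \<subseteq> K"
    and two: "x0 \<in> topspace X" "x1 \<in> topspace X" "x0 \<noteq> x1"
    and f_in: "\<And>g. f g \<in> topspace X"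
    and f_ext: "\<And>C t. countable C \<Longrightarrow> \<forall>c\<in>C. countable c \<Longrightarrow> t ` C \<subseteq> topspace X \<Longrightarrow>
      \<exists>g. countable g \<and> (\<forall>h\<in>C. f (sd g h) = t h)"
begin

text \<open>The topology induced by \<open>g \<mapsto> (f (sd g h))\<^sub>h\<close>, that is, the orbit of \<open>f\<close> under translations.\<close>

definition cyl :: "'i set \<Rightarrow> 'x set \<Rightarrow> 'i set set" where
  "cyl h U = {g. countable g \<and> f (sd g h) \<in> U}"

definition cyls :: "'i set set set" where
  "cyls = {cyl h U | h U. countable h \<and> openin X U}"

definition ktop :: "'i set topology" where
  "ktop = topology_generated_by cyls"

definition box :: "'i set set \<Rightarrow> ('i set \<Rightarrow> 'x set) \<Rightarrow> 'i set set" where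
  "box E W = {g. countable g \<and> (\<forall>h\<in>E. f (sd g h) \<in> W h)}"

lemma Union_cyls: "\<Union>cyls = Collect countable"
proof -
  have "cyl {} (topspace X) = Collect countable" by (simp add: cyl_def f_in)
  moreover have "cyl {} (topspace X) \<in> cyls" unfolding cyls_def by blast
  moreover have "s \<subseteq> Collect countable" if "s \<in> cyls" for s
    using that by (auto simp: cyls_def cyl_def)
  ultimately show ?thesis by blast
qed

lemma topspace_ktop [simp]: "topspace ktop = Collect countable"
  by (simp add: ktop_def Union_cyls)

lemma openin_cyl: "countable h \<Longrightarrow> openin X U \<Longrightarrow> openin ktop (cyl h U)"
  unfolding ktop_def by (intro topology_generated_by_Basis) (auto simp: cyls_def)

lemma box_nbhd:
  assumes "openin ktop N" "g \<in> N"
  obtains E W where "finite E" "\<And>h. h \<in> E \<Longrightarrow> countable h" "\<And>h. h \<in> E \<Longrightarrow> openin X (W h)"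
    "g \<in> box E W" "box E W \<subseteq> N"
proof -
  obtain F where F: "finite F" "F \<subseteq> cyls" "F \<noteq> {}" "g \<in> \<Inter>F" "\<Inter>F \<subseteq> N"
    by (rule generated_nbhd[OF assms(1)[unfolded ktop_def] assms(2)])
  then have "\<forall>s\<in>F. \<exists>h U. s = cyl h U \<and> countable h \<and> openin X U"
    unfolding cyls_def by blast
  then obtain h U where hU: "\<And>s. s \<in> F \<Longrightarrow> s = cyl (h s) (U s)" "\<And>s. s \<in> F \<Longrightarrow> countable (h s)"
    "\<And>s. s \<in> F \<Longrightarrow> openin X (U s)"
    by metis
  \<comment> \<open>Several subbasic sets may constrain the same coordinate; their conditions are
    merged into one.\<close>
  define W where "W k = \<Inter>(U ` {s \<in> F. h s = k})" for k
  have mem: "g' \<in> box (h ` F) W \<longleftrightarrow> g' \<in> \<Inter>F" for g'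
  proof -
    have "g' \<in> box (h ` F) W \<longleftrightarrow> countable g' \<and> (\<forall>s\<in>F. f (sd g' (h s)) \<in> U s)"
      by (auto simp: box_def W_def)
    also have "\<dots> \<longleftrightarrow> (\<forall>s\<in>F. g' \<in> cyl (h s) (U s))"
      using F(3) by (auto simp: cyl_def)
    also have "\<dots> \<longleftrightarrow> (\<forall>s\<in>F. g' \<in> s)"
      using hU(1) by (intro ball_cong refl) simp
    finally show ?thesis by simp
  qed
  show thesis
  proof (rule that)
    show "finite (h ` F)" using F by simp
    show "countable k" if "k \<in> h ` F" for k using that hU by blast
    show "openin X (W k)" if "k \<in> h ` F" for k
      unfolding W_def using that F(1) hU(3) by (intro openin_Inter) auto
    show "g \<in> box (h ` F) W" using F mem by blast
    show "box (h ` F) W \<subseteq> N" using F mem by blast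
  qed
qed

text \<open>Translation by \<open>a\<close> only permutes coordinates, pulling
  \<open>cyl h U\<close> back to \<open>cyl (sd a h) U\<close>. Right translations are left ones by
  commutativity, and inversion is the identity.\<close>

lemma quasitopological_group_ktop: "quasitopological_group sd_group ktop"
proof -
  have left: "continuous_map ktop ktop (\<lambda>x. sd a x)" if a: "countable a" for a
    unfolding ktop_def
  proof (rule continuous_on_generated_topo; fold ktop_def)
    show "(\<lambda>x. sd a x) ` topspace ktop \<subseteq> \<Union>cyls" using a by (auto simp: Union_cyls)
    fix s assume "s \<in> cyls"
    then obtain h U where s: "s = cyl h U" "countable h" "openin X U" unfolding cyls_def by blast
    have "(\<lambda>x. sd a x) -` s \<inter> topspace ktop = cyl (sd a h) U"
      using a by (auto simp: s cyl_def) (metis sd_assoc sd_commute)+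
    then show "openin ktop ((\<lambda>x. sd a x) -` s \<inter> topspace ktop)"
      using openin_cyl a s by simp
  qed
  have "continuous_map ktop ktop (\<lambda>x. inv\<^bsub>sd_group\<^esub> x)"
    by (rule continuous_map_eq[OF continuous_map_id]) (simp add: inv_sd_group)
  with left show ?thesis
    unfolding quasitopological_group_def
    by (simp add: group_sd_group sd_commute[of _ "_ :: 'i set"])
qed

lemma regular_T1_ktop: "regular_T1 ktop"
  unfolding ktop_def
proof (rule regular_T1_generated; fold ktop_def)
  fix s g assume "s \<in> cyls" "g \<in> s"
  then obtain h U where s: "s = cyl h U" "countable h" "openin X U" unfolding cyls_def by blast
  then have "f (sd g h) \<in> U" "countable g" using \<open>g \<in> s\<close> by (auto simp: cyl_def)
  then obtain V where V: "openin X V" "f (sd g h) \<in> V" "X closure_of V \<subseteq> U"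
    using reg s unfolding regular_T1_def by blast
  have "topspace ktop - cyl h (X closure_of V) = cyl h (topspace X - X closure_of V)"
    by (auto simp: cyl_def f_in)
  moreover have "openin ktop (cyl h (topspace X - X closure_of V))"
    using s by (intro openin_cyl openin_diff) auto
  ultimately have "closedin ktop (cyl h (X closure_of V))"
    unfolding closedin_def by (auto simp: cyl_def)
  moreover have "V \<subseteq> X closure_of V" using V by (meson closure_of_subset openin_subset)
  ultimately show "\<exists>V K. openin ktop V \<and> closedin ktop K \<and> g \<in> V \<and> V \<subseteq> K \<and> K \<subseteq> s"
    using V s \<open>countable g\<close>
    by (intro exI[of _ "cyl h V"] exI[of _ "cyl h (X closure_of V)"]) (auto simp: cyl_def intro!: openin_cyl[unfolded cyl_def])
next
  fix g g' assume g: "g \<in> \<Union>cyls" "g' \<in> \<Union>cyls" "g \<noteq> g'"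
  then have c: "countable g" "countable g'" by (simp_all add: Union_cyls)
  \<comment> \<open>Since \<open>sd\<close> is commutative, points and coordinates may exchange
    roles: \<open>f_ext\<close> here provides a coordinate \<open>k\<close> at which
    \<open>g\<close> and \<open>g'\<close> have different values.\<close>
  obtain k where k: "countable k" "f (sd k g) = x0" "f (sd k g') = x1"
    using f_ext[of "{g, g'}" "\<lambda>h. if h = g then x0 else x1"] c g two by auto
  have "t1_space X" using reg by (simp add: regular_T1_def)
  then obtain U where U: "openin X U" "x0 \<in> U" "x1 \<notin> U"
    using two unfolding t1_space_def by metis
  then have "g \<in> cyl k U" "g' \<notin> cyl k U"
    using k c by (auto simp: cyl_def sd_commute[of _ k])
  then show "\<exists>U. openin ktop U \<and> g \<in> U \<and> g' \<notin> U"
    using openin_cyl[OF k(1) U(1)] by blast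
qed

section \<open>Cluster points and feeble compactness\<close>

text \<open>The values on \<open>C\<close> can be prescribed while finitely many other coordinates
  stay as in \<open>g\<close>. Thus the part of a box around \<open>g\<close> that lies outside
  \<open>C\<close> never obstructs a prescription on \<open>C\<close>.\<close>

lemma extend_point:
  assumes "countable C" "\<forall>c\<in>C. countable c" "finite E" "\<forall>c\<in>E. countable c"
    and "\<And>h. h \<in> C \<Longrightarrow> t h \<in> topspace X"
  shows "\<exists>y. countable y \<and> (\<forall>h\<in>C. f (sd y h) = t h) \<and> (\<forall>h\<in>E - C. f (sd y h) = f (sd g h))"
proof -
  have "\<exists>y. countable y \<and> (\<forall>h\<in>C \<union> E. f (sd y h) = (if h \<in> C then t h else f (sd g h)))"
    using assms f_in by (intro f_ext) (auto simp: countable_finite)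
  then show ?thesis by (metis DiffD1 DiffD2 UnCI)
qed

text \<open>Seen through the coordinates in \<open>C\<close>, the set \<open>N\<close> is restricted
  at most at those in \<open>E\<close>, where the values of \<open>e\<close> are good. Since only
  these values of \<open>e\<close> enter, other prescriptions agreeing with \<open>e\<close> on
  \<open>E\<close> can be placed in \<open>N\<close> as well.\<close>

definition realises :: "'i set set \<Rightarrow> 'i set set \<Rightarrow> ('i set \<Rightarrow> 'x) \<Rightarrow> 'i set set \<Rightarrow> bool" where
  "realises C E e N \<longleftrightarrow> (\<forall>d. (\<forall>h\<in>C. d h \<in> topspace X) \<and> (\<forall>h\<in>E. d h = e h) \<longrightarrow>
    (\<exists>y\<in>N. \<forall>h\<in>C. f (sd y h) = d h))"

text \<open>At each coordinate the values \<open>d n h\<close> stay in a compact set, so they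
  cluster at a point of the countable product over \<open>C\<close>, which is lifted to a group
  element \<open>g\<close>. A box around \<open>g\<close> constrains finitely many coordinates:
  those in \<open>C\<close> are satisfied by infinitely many \<open>d n\<close>, the others by
  \<open>extend_point\<close>.\<close>

lemma cluster:
  fixes d :: "nat \<Rightarrow> 'i set \<Rightarrow> 'x"
  assumes C: "countable C" "\<forall>c\<in>C. countable c"
    and d: "\<And>n h. h \<in> C \<Longrightarrow> d n h \<in> D"
  shows "\<exists>g. countable g \<and> (\<forall>N. openin ktop N \<and> g \<in> N \<longrightarrow>
    (\<exists>E. finite E \<and> E \<subseteq> C \<and> infinite {n. realises C E (d n) N}))"
proof -
  have "\<exists>K. compactin X K \<and> range (\<lambda>n. d n h) \<subseteq> K" if "h \<in> C" for h
    using d that by (intro countable_compact) auto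
  then obtain K where K: "\<And>h. h \<in> C \<Longrightarrow> compactin X (K h)" "\<And>h n. h \<in> C \<Longrightarrow> d n h \<in> K h"
    by (metis rangeI subsetD)
  let ?P = "product_topology (\<lambda>_. X) C"
  have "compactin ?P (PiE C K)" using K(1) by (simp add: compactin_PiE)
  moreover have "range (\<lambda>n. restrict (d n) C) \<subseteq> PiE C K" using K(2) by auto
  ultimately have "\<exists>x\<in>PiE C K. \<forall>V. openin ?P V \<and> x \<in> V \<longrightarrow> infinite {n. restrict (d n) C \<in> V}"
    by (rule compactin_sequence_cluster)
  then obtain x where x: "x \<in> PiE C K"
    "\<And>V. openin ?P V \<Longrightarrow> x \<in> V \<Longrightarrow> infinite {n. restrict (d n) C \<in> V}"
    by blast
  have xX: "x h \<in> topspace X" if "h \<in> C" for h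
    using x(1) that compactin_subset_topspace[OF K(1)[OF that]] by blast
  then obtain g where g: "countable g" "\<And>h. h \<in> C \<Longrightarrow> f (sd g h) = x h"
    using f_ext[OF C, of x] by blast
  show ?thesis
  proof (rule exI[of _ g], rule conjI[OF g(1)], intro allI impI, elim conjE)
    fix N assume "openin ktop N" "g \<in> N"
    then obtain E W where EW: "finite E" "\<And>h. h \<in> E \<Longrightarrow> countable h" "\<And>h. h \<in> E \<Longrightarrow> openin X (W h)"
      "g \<in> box E W" "box E W \<subseteq> N"
      by (rule box_nbhd) blast
    define V where "V = PiE C (\<lambda>h. if h \<in> E then W h else topspace X)"
    have "openin ?P V"
      unfolding V_def openin_PiE_gen
      using EW(1,3) by (auto intro!: finite_subset[OF _ EW(1)])
    moreover have "x \<in> V"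
      unfolding V_def using x(1) xX g(2) EW(4) by (auto simp: box_def PiE_iff)
    ultimately have inf: "infinite {n. restrict (d n) C \<in> V}" using x(2)[of V] by simp
    have "\<exists>y\<in>N. \<forall>h\<in>C. f (sd y h) = d' h"
      if n: "restrict (d n) C \<in> V" and d': "\<forall>h\<in>C. d' h \<in> topspace X" "\<forall>h\<in>E \<inter> C. d' h = d n h" for n d'
    proof -
      have "\<exists>y. countable y \<and> (\<forall>h\<in>C. f (sd y h) = d' h) \<and> (\<forall>h\<in>E - C. f (sd y h) = f (sd g h))"
        by (rule extend_point[OF C EW(1)]) (use EW(2) d'(1) in auto)
      then obtain y where y: "countable y" "\<And>h. h \<in> C \<Longrightarrow> f (sd y h) = d' h"
        "\<And>h. h \<in> E - C \<Longrightarrow> f (sd y h) = f (sd g h)"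
        by blast
      have "f (sd y h) \<in> W h" if "h \<in> E" for h
      proof (cases "h \<in> C")
        case True
        then have "d n h \<in> W h" using n that by (auto simp: V_def PiE_iff)
        then show ?thesis using y(2)[OF True] d'(2) True that by simp
      next
        case False
        then show ?thesis using y(3)[of h] that EW(4) by (simp add: box_def)
      qed
      then have "y \<in> N" using EW(5) y(1) by (auto simp: box_def)
      then show ?thesis using y(2) by blast
    qed
    then have "{n. restrict (d n) C \<in> V} \<subseteq> {n. realises C (E \<inter> C) (d n) N}"
      unfolding realises_def by blast
    then have "infinite {n. realises C (E \<inter> C) (d n) N}"
      using inf by (rule infinite_super)
    then show "\<exists>E. finite E \<and> E \<subseteq> C \<and> infinite {n. realises C E (d n) N}"
      using EW(1) by (intro exI[of _ "E \<inter> C"]) simp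
  qed
qed

text \<open>Each of infinitely many nonempty open sets contains a nonempty box, in which values from
  \<open>D\<close> are chosen. A neighbourhood of a cluster point of these choices realises
  infinitely many of them and so meets infinitely many of the sets.\<close>

lemma feebly_compact_ktop: "feebly_compact ktop"
  unfolding feebly_compact_def
proof (intro allI impI, rule ccontr)
  fix \<A> assume A: "(\<forall>A\<in>\<A>. openin ktop A) \<and> locally_finite_in ktop \<A>" and "infinite \<A>"
  then have "infinite (\<A> - {{}})" by simp
  then obtain A :: "nat \<Rightarrow> 'i set set" where inj: "inj A" and rng: "range A \<subseteq> \<A> - {{}}"
    using infinite_countable_subset by blast
  have "\<exists>E W. finite E \<and> (\<forall>h\<in>E. countable h \<and> openin X (W h) \<and> W h \<noteq> {}) \<and> box E W \<subseteq> A n" for n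
  proof -
    obtain a where "a \<in> A n" "openin ktop (A n)" using rng A by blast
    then obtain E W where "finite E" "\<And>h. h \<in> E \<Longrightarrow> countable h" "\<And>h. h \<in> E \<Longrightarrow> openin X (W h)"
      "a \<in> box E W" "box E W \<subseteq> A n"
      using box_nbhd by metis
    then show ?thesis by (intro exI[of _ E] exI[of _ W]) (auto simp: box_def)
  qed
  then obtain E W where EW: "\<And>n. finite (E n)" "\<And>n h. h \<in> E n \<Longrightarrow> countable h"
    "\<And>n h. h \<in> E n \<Longrightarrow> openin X (W n h)" "\<And>n h. h \<in> E n \<Longrightarrow> W n h \<noteq> {}"
    "\<And>n. box (E n) (W n) \<subseteq> A n"
    by metis
  have ex: "\<exists>e\<in>D. h \<in> E n \<longrightarrow> e \<in> W n h" for n h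
  proof (cases "h \<in> E n")
    case False
    have "\<exists>e\<in>D. e \<in> topspace X" using two(1) by (intro dense) auto
    then show ?thesis using False by blast
  next
    case True
    then show ?thesis using dense[OF EW(3)[OF True] EW(4)[OF True]] by blast
  qed
  define d where "d n h = (SOME e. e \<in> D \<and> (h \<in> E n \<longrightarrow> e \<in> W n h))" for n h
  have "d n h \<in> D \<and> (h \<in> E n \<longrightarrow> d n h \<in> W n h)" for n h
    unfolding d_def by (rule someI_ex) (use ex[of h n] in blast)
  then have d: "\<And>n h. d n h \<in> D" "\<And>n h. h \<in> E n \<Longrightarrow> d n h \<in> W n h"
    by blast+
  define C where "C = (\<Union>n. E n)"
  have C: "countable C" "\<forall>c\<in>C. countable c" using EW(1,2) by (auto simp: C_def countable_finite)
  have "\<exists>g. countable g \<and> (\<forall>N. openin ktop N \<and> g \<in> N \<longrightarrow>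
      (\<exists>E. finite E \<and> E \<subseteq> C \<and> infinite {n. realises C E (d n) N}))"
    by (rule cluster[OF C d(1)])
  then obtain g where g: "countable g" "\<And>N. openin ktop N \<Longrightarrow> g \<in> N \<Longrightarrow>
      \<exists>E. finite E \<and> E \<subseteq> C \<and> infinite {n. realises C E (d n) N}"
    by blast
  obtain N where N: "openin ktop N" "g \<in> N" "finite {U \<in> \<A>. U \<inter> N \<noteq> {}}"
    using A g(1) unfolding locally_finite_in_def by auto
  obtain F where "infinite {n. realises C F (d n) N}" (is "infinite ?I")
    using g(2)[OF N(1,2)] by blast
  moreover have "A n \<in> {U \<in> \<A>. U \<inter> N \<noteq> {}}" if "n \<in> ?I" for n
  proof -
    obtain y where y: "y \<in> N" "\<forall>h\<in>C. f (sd y h) = d n h"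
      using \<open>n \<in> ?I\<close> d(1) D unfolding realises_def by blast
    moreover have "countable y" using y(1) openin_subset[OF N(1)] by auto
    ultimately have "y \<in> box (E n) (W n)"
      using d(2) by (auto simp: box_def C_def)
    then show ?thesis using y EW(5) rng by blast
  qed
  then have "A ` ?I \<subseteq> {U \<in> \<A>. U \<inter> N \<noteq> {}}" by (rule image_subsetI)
  then have "finite (A ` ?I)" using N(3) by (rule finite_subset)
  moreover have "inj_on A ?I" using inj by (rule inj_on_subset) simp
  ultimately show False using finite_imageD by blast
qed

section \<open>Continuous real functions on the group\<close>

text \<open>A pair showing that \<open>C\<close> does not determine \<open>\<phi>\<close> up to
  \<open>\<epsilon>\<close> can be moved into \<open>D\<close>, and its gap then depends on finitely
  many coordinates only. This makes it fit for \<open>cluster\<close>.\<close>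

lemma separate_values:
  assumes \<phi>: "continuous_map ktop euclideanreal \<phi>" and C: "finite C" "\<forall>c\<in>C. countable c"
    and g: "countable g" "countable g'" "\<And>h. h \<in> C \<Longrightarrow> f (sd g h) = f (sd g' h)"
    and \<epsilon>: "\<bar>\<phi> g - \<phi> g'\<bar> > \<epsilon>"
  shows "\<exists>E d d'. finite E \<and> C \<subseteq> E \<and> (\<forall>c\<in>E. countable c) \<and> range d \<subseteq> D \<and> range d' \<subseteq> D
    \<and> (\<forall>h\<in>C. d h = d' h)
    \<and> (\<forall>y y'. countable y \<and> countable y' \<and> (\<forall>h\<in>E. f (sd y h) = d h) \<and> (\<forall>h\<in>E. f (sd y' h) = d' h)
        \<longrightarrow> \<bar>\<phi> y - \<phi> y'\<bar> > \<epsilon>)"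
proof -
  \<comment> \<open>Half of the excess over \<open>\<epsilon>\<close>: two errors below
    \<open>\<delta>\<close> still leave a gap larger than \<open>\<epsilon>\<close>.\<close>
  define \<delta> where "\<delta> = (\<bar>\<phi> g - \<phi> g'\<bar> - \<epsilon>) / 2"
  have "\<delta> > 0" using \<epsilon> by (simp add: \<delta>_def)
  have op: "openin ktop {y \<in> topspace ktop. \<phi> y \<in> {r. \<bar>r - u\<bar> < \<delta>}}" for u
  proof (rule openin_continuous_map_preimage[OF \<phi>])
    have "{r. \<bar>r - u\<bar> < \<delta>} = ball u \<delta>" by (auto simp: dist_real_def)
    then show "openin euclideanreal {r. \<bar>r - u\<bar> < \<delta>}" by simp
  qed
  obtain E1 W1 where 1: "finite E1" "\<And>h. h \<in> E1 \<Longrightarrow> countable h" "\<And>h. h \<in> E1 \<Longrightarrow> openin X (W1 h)"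
    "g \<in> box E1 W1" "box E1 W1 \<subseteq> {y \<in> topspace ktop. \<phi> y \<in> {r. \<bar>r - \<phi> g\<bar> < \<delta>}}"
    using g(1) \<open>\<delta> > 0\<close> by (rule_tac box_nbhd[OF op[of "\<phi> g"], of g]) auto
  obtain E2 W2 where 2: "finite E2" "\<And>h. h \<in> E2 \<Longrightarrow> countable h" "\<And>h. h \<in> E2 \<Longrightarrow> openin X (W2 h)"
    "g' \<in> box E2 W2" "box E2 W2 \<subseteq> {y \<in> topspace ktop. \<phi> y \<in> {r. \<bar>r - \<phi> g'\<bar> < \<delta>}}"
    using g(2) \<open>\<delta> > 0\<close> by (rule_tac box_nbhd[OF op[of "\<phi> g'"], of g']) auto
  \<comment> \<open>On \<open>C\<close> the two points agree, so the intersection of both conditions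
    is nonempty and one value serves both; this keeps \<open>d\<close> and \<open>d'\<close> equal
    on \<open>C\<close>.\<close>
  have "\<exists>e\<in>D. (h \<in> E1 \<longrightarrow> e \<in> W1 h) \<and> (h \<in> E2 \<longrightarrow> h \<in> C \<longrightarrow> e \<in> W2 h)" for h
  proof -
    let ?W = "(if h \<in> E1 then W1 h else topspace X) \<inter> (if h \<in> E2 \<and> h \<in> C then W2 h else topspace X)"
    have "openin X ?W" using 1(3) 2(3) by (intro openin_Int) auto
    moreover have "f (sd g h) \<in> ?W" using 1(4) 2(4) g(3) f_in by (auto simp: box_def)
    ultimately have "\<exists>e\<in>D. e \<in> ?W" by (intro dense) blast+
    then show ?thesis by (auto split: if_splits)
  qed
  then obtain d where d: "\<And>h. d h \<in> D" "\<And>h. h \<in> E1 \<Longrightarrow> d h \<in> W1 h"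
    "\<And>h. h \<in> E2 \<Longrightarrow> h \<in> C \<Longrightarrow> d h \<in> W2 h"
    by metis
  have "\<exists>e\<in>D. h \<in> E2 \<longrightarrow> e \<in> W2 h" for h
  proof -
    let ?W = "if h \<in> E2 then W2 h else topspace X"
    have "openin X ?W" using 2(3) by auto
    moreover have "f (sd g' h) \<in> ?W" using 2(4) f_in by (auto simp: box_def)
    ultimately have "\<exists>e\<in>D. e \<in> ?W" by (intro dense) blast+
    then show ?thesis by (auto split: if_splits)
  qed
  then obtain e where e: "\<And>h. e h \<in> D" "\<And>h. h \<in> E2 \<Longrightarrow> e h \<in> W2 h" by metis
  define d' where "d' h = (if h \<in> C then d h else e h)" for h
  have "\<bar>\<phi> y - \<phi> y'\<bar> > \<epsilon>"
    if y: "countable y" "countable y'" "\<forall>h\<in>E1 \<union> E2 \<union> C. f (sd y h) = d h"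
      "\<forall>h\<in>E1 \<union> E2 \<union> C. f (sd y' h) = d' h" for y y'
  proof -
    have "y \<in> box E1 W1" "y' \<in> box E2 W2"
      using y d e by (auto simp: box_def d'_def)
    then have "\<bar>\<phi> y - \<phi> g\<bar> < \<delta>" "\<bar>\<phi> y' - \<phi> g'\<bar> < \<delta>" using 1(5) 2(5) by auto
    moreover have "2 * \<delta> = \<bar>\<phi> g - \<phi> g'\<bar> - \<epsilon>" by (simp add: \<delta>_def)
    ultimately show ?thesis by linarith
  qed
  then show ?thesis
    using 1(1,2) 2(1,2) C d(1) e(1)
    by (intro exI[of _ "E1 \<union> E2 \<union> C"] exI[of _ d] exI[of _ d']) (auto simp: d'_def)
qed

text \<open>Otherwise \<open>separate_values\<close>, iterated from the empty set, gives finite sets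
  \<open>S n\<close> and prescriptions that agree on \<open>S n\<close> but force a gap beyond
  \<open>\<epsilon>\<close> once followed on \<open>S (Suc n)\<close>. Near a cluster point of the
  first prescriptions \<open>\<phi>\<close> varies by less than \<open>\<epsilon>\<close>, yet both
  prescriptions of some pair are realised there.\<close>

lemma finite_dependence:
  assumes \<phi>: "continuous_map ktop euclideanreal \<phi>" and "\<epsilon> > 0"
  shows "\<exists>C. finite C \<and> (\<forall>c\<in>C. countable c) \<and> (\<forall>g g'. countable g \<and> countable g' \<and>
    (\<forall>h\<in>C. f (sd g h) = f (sd g' h)) \<longrightarrow> \<bar>\<phi> g - \<phi> g'\<bar> \<le> \<epsilon>)"
    (is "\<exists>C. finite C \<and> ?countable C \<and> ?dep C")
proof (rule ccontr)
  assume contra: "\<not> ?thesis"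
  define Q where "Q C E d d' \<longleftrightarrow> finite E \<and> C \<subseteq> E \<and> (\<forall>c\<in>E. countable c) \<and> range d \<subseteq> D \<and> range d' \<subseteq> D
    \<and> (\<forall>h\<in>C. d h = d' h)
    \<and> (\<forall>y y'. countable y \<and> countable y' \<and> (\<forall>h\<in>E. f (sd y h) = d h) \<and> (\<forall>h\<in>E. f (sd y' h) = d' h)
        \<longrightarrow> \<bar>\<phi> y - \<phi> y'\<bar> > \<epsilon>)" for C E :: "'i set set" and d d'
  have "\<exists>E d d'. Q C E d d'" if C: "finite C" "\<forall>c\<in>C. countable c" for C
  proof -
    have "\<not> ?dep C" using contra
      by (rule contrapos_nn) (intro exI[of _ C] conjI C)
    then obtain g g' where g: "countable g" "countable g'" "\<And>h. h \<in> C \<Longrightarrow> f (sd g h) = f (sd g' h)"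
      "\<epsilon> < \<bar>\<phi> g - \<phi> g'\<bar>"
      unfolding not_all not_imp not_le by blast
    show ?thesis unfolding Q_def by (rule separate_values[OF \<phi> C g])
  qed
  then obtain E d d' where Q: "\<And>C. finite C \<Longrightarrow> \<forall>c\<in>C. countable c \<Longrightarrow> Q C (E C) (d C) (d' C)"
    by metis
  define S where "S n = (E ^^ n) {}" for n
  have fin: "finite (S n) \<and> (\<forall>c\<in>S n. countable c)" for n
  proof (induction n)
    case (Suc n)
    then have "Q (S n) (E (S n)) (d (S n)) (d' (S n))" using Q by blast
    then show ?case by (simp add: S_def Q_def)
  qed (simp add: S_def)
  have QS: "Q (S n) (S (Suc n)) (d (S n)) (d' (S n))" for n
    using Q fin[of n] by (simp add: S_def)
  then have "S n \<subseteq> S (Suc n)" for n by (simp add: Q_def)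
  then have mono: "m \<le> n \<Longrightarrow> S m \<subseteq> S n" for m n
    by (rule lift_Suc_mono_le)
  define C where "C = (\<Union>n. S n)"
  have C: "countable C" "\<forall>c\<in>C. countable c" using fin by (auto simp: C_def countable_finite)
  have dD: "d (S n) h \<in> D" "d' (S n) h \<in> D" for n h
    using QS[of n] unfolding Q_def by auto
  have "\<exists>g. countable g \<and> (\<forall>N. openin ktop N \<and> g \<in> N \<longrightarrow>
      (\<exists>E. finite E \<and> E \<subseteq> C \<and> infinite {n. realises C E (d (S n)) N}))"
    by (rule cluster[OF C dD(1)])
  then obtain g where g: "countable g" "\<And>N. openin ktop N \<Longrightarrow> g \<in> N \<Longrightarrow>
      \<exists>E. finite E \<and> E \<subseteq> C \<and> infinite {n. realises C E (d (S n)) N}"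
    by blast
  let ?N = "{y \<in> topspace ktop. \<phi> y \<in> ball (\<phi> g) (\<epsilon> / 2)}"
  have N: "openin ktop ?N" by (rule openin_continuous_map_preimage[OF \<phi>]) simp
  have "g \<in> ?N" using g(1) \<open>\<epsilon> > 0\<close> by simp
  then obtain F where F: "finite F" "F \<subseteq> C" "infinite {n. realises C F (d (S n)) ?N}" (is "infinite ?I")
    using g(2)[OF N] by blast
  have "\<exists>m. F \<subseteq> S m"
    using F(1,2)
  proof (induction F)
    case (insert h F)
    then obtain m k where "F \<subseteq> S m" "h \<in> S k" by (auto simp: C_def)
    then have "insert h F \<subseteq> S (max m k)" using mono[of m "max m k"] mono[of k "max m k"] by auto
    then show ?case by blast
  qed simp
  then obtain m where m: "F \<subseteq> S m" by blast
  \<comment> \<open>For \<open>n\<close> at least \<open>m\<close> the set \<open>F\<close> lies in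
    \<open>S n\<close>, where the two prescriptions agree; so the second one is realised in
    \<open>?N\<close> along with the first.\<close>
  obtain n where n: "n \<in> ?I" "m \<le> n" using F(3) infinite_nat_iff_unbounded_le by blast
  have eq: "d' (S n) h = d (S n) h" if "h \<in> F" for h
    using that m mono[OF n(2)] QS[of n] unfolding Q_def by auto
  have all: "\<exists>y\<in>?N. \<forall>h\<in>C. f (sd y h) = e h"
    if "\<forall>h\<in>C. e h \<in> topspace X" "\<forall>h\<in>F. e h = d (S n) h" for e
    using n(1) that unfolding realises_def by blast
  obtain y where y: "y \<in> ?N" "\<forall>h\<in>C. f (sd y h) = d (S n) h"
    using all[of "d (S n)"] dD(1) D by blast
  obtain y' where y': "y' \<in> ?N" "\<forall>h\<in>C. f (sd y' h) = d' (S n) h"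
    using all[of "d' (S n)"] dD(2) D eq by blast
  have "S (Suc n) \<subseteq> C" by (auto simp: C_def)
  then have "\<forall>h\<in>S (Suc n). f (sd y h) = d (S n) h" "\<forall>h\<in>S (Suc n). f (sd y' h) = d' (S n) h"
    using y(2) y'(2) by blast+
  moreover have "countable y" "countable y'" using y(1) y'(1) by auto
  ultimately have "\<bar>\<phi> y - \<phi> y'\<bar> > \<epsilon>"
    using QS[of n] unfolding Q_def by blast
  moreover have "\<bar>\<phi> g - \<phi> y\<bar> < \<epsilon> / 2" "\<bar>\<phi> g - \<phi> y'\<bar> < \<epsilon> / 2"
    using y(1) y'(1) by (auto simp: dist_real_def)
  ultimately show False by linarith
qed

text \<open>Let the \<open>k\<close>-th coordinate run through \<open>X\<close> with the rest of
  \<open>C\<close> fixed. The lift \<open>\<gamma>\<close> is uncontrolled outside \<open>C\<close>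
  and need not be continuous, but its composition with \<open>\<phi>\<close> is:
  \<open>\<phi>\<close> sees only \<open>C\<close>, so a nearby lift may be replaced by one that
  agrees with \<open>\<gamma> x\<close> on the finitely many outer coordinates of a box. Rigidity of
  \<open>X\<close> then applies.\<close>

lemma change_one_coordinate:
  assumes \<phi>: "continuous_map ktop euclideanreal \<phi>" and C: "countable C" "\<forall>c\<in>C. countable c"
    and dep: "\<And>g g'. countable g \<Longrightarrow> countable g' \<Longrightarrow> \<forall>h\<in>C. f (sd g h) = f (sd g' h) \<Longrightarrow> \<phi> g = \<phi> g'"
    and g: "countable g" "countable g'" "\<forall>h\<in>C - {k}. f (sd g h) = f (sd g' h)"
    and k: "k \<in> C"
  shows "\<phi> g = \<phi> g'"
proof -
  have "\<exists>y. countable y \<and> (\<forall>h\<in>C. f (sd y h) = (if h = k then x else f (sd g h)))"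
    if "x \<in> topspace X" for x
    using C that f_in by (intro f_ext) auto
  then obtain \<gamma> where \<gamma>: "\<And>x. x \<in> topspace X \<Longrightarrow> countable (\<gamma> x)"
    "\<And>x h. x \<in> topspace X \<Longrightarrow> h \<in> C \<Longrightarrow> f (sd (\<gamma> x) h) = (if h = k then x else f (sd g h))"
    by metis
  have "continuous_map X euclideanreal (\<lambda>x. \<phi> (\<gamma> x))"
    unfolding continuous_map_def
  proof (intro conjI allI impI)
    fix U :: "real set" assume U: "openin euclideanreal U"
    have N: "openin ktop {y \<in> topspace ktop. \<phi> y \<in> U}"
      using \<phi> U by (rule openin_continuous_map_preimage)
    show "openin X {x \<in> topspace X. \<phi> (\<gamma> x) \<in> U}"
    proof (subst openin_subopen, intro ballI)
      fix x assume x: "x \<in> {x \<in> topspace X. \<phi> (\<gamma> x) \<in> U}"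
      then have "\<gamma> x \<in> {y \<in> topspace ktop. \<phi> y \<in> U}" using \<gamma>(1) by auto
      then obtain E W where EW: "finite E" "\<And>h. h \<in> E \<Longrightarrow> countable h" "\<And>h. h \<in> E \<Longrightarrow> openin X (W h)"
        "\<gamma> x \<in> box E W" "box E W \<subseteq> {y \<in> topspace ktop. \<phi> y \<in> U}"
        by (rule box_nbhd[OF N]) blast
      let ?V = "if k \<in> E then W k else topspace X"
      have "\<phi> (\<gamma> x') \<in> U" if x': "x' \<in> ?V" "x' \<in> topspace X" for x'
      proof -
        have "\<exists>y. countable y \<and> (\<forall>h\<in>C. f (sd y h) = f (sd (\<gamma> x') h)) \<and>
            (\<forall>h\<in>E - C. f (sd y h) = f (sd (\<gamma> x) h))"
          by (rule extend_point[OF C EW(1)]) (use EW(2) f_in in auto)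
        then obtain y where y: "countable y" "\<And>h. h \<in> C \<Longrightarrow> f (sd y h) = f (sd (\<gamma> x') h)"
          "\<And>h. h \<in> E - C \<Longrightarrow> f (sd y h) = f (sd (\<gamma> x) h)"
          by blast
        have "f (sd y h) \<in> W h" if "h \<in> E" for h
        proof (cases "h \<in> C \<and> h \<noteq> k")
          case True
          then have "f (sd y h) = f (sd (\<gamma> x) h)" using x x' y(2) \<gamma>(2) by simp
          then show ?thesis using EW(4) that by (simp add: box_def)
        next
          case False
          then show ?thesis
            using that x' y(2,3) \<gamma>(2)[OF x'(2) k] k EW(4) by (cases "h = k") (auto simp: box_def)
        qed
        then have "\<phi> y \<in> U" using EW(5) y(1) by (auto simp: box_def)
        moreover have "\<phi> y = \<phi> (\<gamma> x')" using y \<gamma>(1)[OF x'(2)] by (intro dep) auto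
        ultimately show ?thesis by simp
      qed
      moreover have "openin X ?V" using EW(3) by simp
      moreover have "x \<in> ?V"
        using x EW(4) \<gamma>(2)[of x k] k by (auto simp: box_def)
      moreover have "?V \<subseteq> topspace X" using \<open>openin X ?V\<close> by (rule openin_subset)
      ultimately show "\<exists>V. openin X V \<and> x \<in> V \<and> V \<subseteq> {x \<in> topspace X. \<phi> (\<gamma> x) \<in> U}"
        by (intro exI[of _ ?V]) blast
    qed
  qed simp
  then obtain c where c: "\<And>x. x \<in> topspace X \<Longrightarrow> \<phi> (\<gamma> x) = c"
    using rigid unfolding R_rigid_def by blast
  have "\<phi> g = \<phi> (\<gamma> (f (sd g k)))"
    using g(1) \<gamma> f_in by (intro dep) auto
  moreover have "\<phi> g' = \<phi> (\<gamma> (f (sd g' k)))"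
    using g \<gamma> f_in by (intro dep) auto
  ultimately show ?thesis using c f_in by simp
qed

text \<open>Collecting the finite sets for all precisions gives a countable \<open>C\<close> that
  determines \<open>\<phi>\<close> exactly. Changing \<open>g\<close> into \<open>g'\<close> on
  \<open>S n\<close> alone takes finitely many single steps and leaves \<open>\<phi>\<close> fixed,
  but already brings it within \<open>1 / (n + 1)\<close> of its value at \<open>g'\<close>.\<close>

lemma R_rigid_ktop: "R_rigid ktop"
  unfolding R_rigid_def
proof (intro allI impI)
  fix \<phi> assume \<phi>: "continuous_map ktop euclideanreal \<phi>"
  have "\<exists>C. finite C \<and> (\<forall>c\<in>C. countable c) \<and> (\<forall>g g'. countable g \<and> countable g' \<and>
    (\<forall>h\<in>C. f (sd g h) = f (sd g' h)) \<longrightarrow> \<bar>\<phi> g - \<phi> g'\<bar> \<le> inverse (real (Suc n)))" for n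
    by (rule finite_dependence[OF \<phi>]) simp
  then obtain S where S: "\<And>n. finite (S n)" "\<And>n. \<forall>c\<in>S n. countable c"
    "\<And>n g g'. countable g \<Longrightarrow> countable g' \<Longrightarrow> \<forall>h\<in>S n. f (sd g h) = f (sd g' h) \<Longrightarrow>
      \<bar>\<phi> g - \<phi> g'\<bar> \<le> inverse (real (Suc n))"
    by metis
  define C where "C = (\<Union>n. S n)"
  have C: "countable C" "\<forall>c\<in>C. countable c" using S(1,2) by (auto simp: C_def countable_finite)
  have small: "u = v" if "\<And>n. \<bar>u - v\<bar> \<le> inverse (real (Suc n))" for u v :: real
  proof (rule ccontr)
    assume "u \<noteq> v"
    then obtain n where "inverse (real (Suc n)) < \<bar>u - v\<bar>"
      using reals_Archimedean[of "\<bar>u - v\<bar>"] by auto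
    with that[of n] show False by linarith
  qed
  have dep: "\<phi> g = \<phi> g'" if "countable g" "countable g'" "\<forall>h\<in>C. f (sd g h) = f (sd g' h)" for g g'
    using that by (intro small S(3)) (auto simp: C_def)
  have change: "\<phi> g = \<phi> g'"
    if "finite F" "F \<subseteq> C" "countable g" "countable g'" "\<forall>h\<in>C - F. f (sd g h) = f (sd g' h)" for F g g'
    using that
  proof (induction F arbitrary: g)
    case empty
    then show ?case by (intro dep) auto
  next
    case (insert k F)
    have "\<exists>y. countable y \<and> (\<forall>h\<in>C. f (sd y h) = (if h = k then f (sd g' h) else f (sd g h)))"
      using C f_in by (intro f_ext) auto
    then obtain y where y: "countable y"
      "\<And>h. h \<in> C \<Longrightarrow> f (sd y h) = (if h = k then f (sd g' h) else f (sd g h))"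
      by blast
    have "\<phi> g = \<phi> y"
      by (rule change_one_coordinate[OF \<phi> C dep, of g y k]) (use insert.prems y in auto)
    also have "\<phi> y = \<phi> g'"
      by (rule insert.IH) (use insert.prems y in auto)
    finally show ?case .
  qed
  have eq: "\<phi> g = \<phi> g'" if g: "countable g" "countable g'" for g g'
  proof (rule small)
    fix n
    have "\<exists>y. countable y \<and> (\<forall>h\<in>C. f (sd y h) = (if h \<in> S n then f (sd g' h) else f (sd g h)))"
      using C f_in by (intro f_ext) auto
    then obtain y where y: "countable y"
      "\<And>h. h \<in> C \<Longrightarrow> f (sd y h) = (if h \<in> S n then f (sd g' h) else f (sd g h))"
      by blast
    have "\<phi> g = \<phi> y"
      by (rule change[of "S n"]) (use S(1) g y in \<open>auto simp: C_def\<close>)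
    moreover have "\<bar>\<phi> y - \<phi> g'\<bar> \<le> inverse (real (Suc n))"
    proof (rule S(3))
      show "\<forall>h\<in>S n. f (sd y h) = f (sd g' h)"
      proof
        fix h assume "h \<in> S n"
        moreover from this have "h \<in> C" by (auto simp: C_def)
        ultimately show "f (sd y h) = f (sd g' h)" using y(2) by simp
      qed
    qed (use g y in auto)
    ultimately show "\<bar>\<phi> g - \<phi> g'\<bar> \<le> inverse (real (Suc n))" by simp
  qed
  have "\<forall>x\<in>topspace ktop. \<phi> x = \<phi> {}" by (intro ballI eq) auto
  then show "\<exists>c. \<forall>x\<in>topspace ktop. \<phi> x = c" by (rule exI)
qed

end

section \<open>The index type and the conclusion\<close>

text \<open>An \<open>ordw\<close> is a set of naturals, so a corkscrew point amounts to a set of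
  pairs in \<open>int \<times> nat\<close> with an integer tag, that is, to a subset of a countable
  type. Members of the hyperspace are then coded in \<open>real set set\<close>.\<close>

lemma inj_cork_code: "\<exists>\<eta> :: (int \<Rightarrow> ordw) \<times> int \<Rightarrow> real set. inj \<eta>"
proof -
  let ?c = "\<lambda>z :: (int \<times> nat) + int. real (to_nat z)"
  have c: "inj ?c" by (intro inj_onI) simp
  define \<eta> where "\<eta> p = ?c ` (Inl ` (SIGMA j:UNIV. Rep_ordw (fst p j)) \<union> {Inr (snd p)})"
    for p :: "(int \<Rightarrow> ordw) \<times> int"
  have "p = q" if "\<eta> p = \<eta> q" for p q
  proof -
    have eq: "Inl ` (SIGMA j:UNIV. Rep_ordw (fst p j)) \<union> {Inr (snd p)} =
        Inl ` (SIGMA j:UNIV. Rep_ordw (fst q j)) \<union> {Inr (snd q)}"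
      using that c unfolding \<eta>_def by (simp only: inj_image_eq_iff)
    have "Inr (snd p) \<in> Inl ` (SIGMA j:UNIV. Rep_ordw (fst q j)) \<union> {Inr (snd q)}"
      unfolding eq[symmetric] by simp
    then have "snd p = snd q" by auto
    moreover have "n \<in> Rep_ordw (fst p j) \<longleftrightarrow> n \<in> Rep_ordw (fst q j)" for n j
    proof -
      have "Inl (j, n) \<in> Inl ` (SIGMA j:UNIV. Rep_ordw (fst p j)) \<union> {Inr (snd p)} \<longleftrightarrow>
          Inl (j, n) \<in> Inl ` (SIGMA j:UNIV. Rep_ordw (fst q j)) \<union> {Inr (snd q)}"
        unfolding eq ..
      then show ?thesis by auto
    qed
    then have "Rep_ordw (fst p j) = Rep_ordw (fst q j)" for j by blast
    then have "fst p = fst q" by (simp add: Rep_ordw_inject fun_eq_iff)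
    ultimately show ?thesis by (simp add: prod_eq_iff)
  qed
  then show ?thesis by (intro exI[of _ \<eta>] injI)
qed

text \<open>The index type has to absorb sequences of its own elements. The negative number
  \<open>- n - 1\<close> records the position and \<open>exp\<close> moves the members of
  \<open>S\<close> to the positive reals, so \<open>j n S\<close> determines both \<open>n\<close>
  and \<open>S\<close>, and the union over \<open>n\<close> loses nothing.\<close>

lemma inj_sequences: "\<exists>J :: (nat \<Rightarrow> real set set) \<Rightarrow> real set set. inj J"
proof -
  define j :: "nat \<Rightarrow> real set \<Rightarrow> real set" where "j n S = insert (- real n - 1) (exp ` S)" for n S
  have neg: "x \<in> j n S \<and> x < 0 \<longleftrightarrow> x = - real n - 1" for x n S
    by (auto simp: j_def)
  have pos: "exp x \<in> j n S \<longleftrightarrow> x \<in> S" for x n S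
  proof -
    have "- real n - 1 < exp x" using exp_gt_zero[of x] by linarith
    then show ?thesis by (auto simp: j_def)
  qed
  have j: "n = m \<and> S = T" if "j n S = j m T" for n m S T
  proof -
    have "- real n - 1 = - real m - 1" using neg[of _ n S] neg[of _ m T] that by metis
    moreover have "S = T" using pos[of _ n S] pos[of _ m T] that by blast
    ultimately show ?thesis by simp
  qed
  define J where "J u = (\<Union>n. j n ` u n)" for u
  have "S \<in> u n \<longleftrightarrow> j n S \<in> J u" for S u n
    unfolding J_def using j by blast
  then have "inj J" by (intro injI ext) blast
  then show ?thesis by blast
qed

theorem theorem5p1:
  "\<exists>(G :: real set set set monoid) (T :: real set set set topology).
     quasitopological_group G T \<and> infinite (carrier G) \<and>
     regular_T1 T \<and> feebly_compact T \<and> R_rigid T \<and>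
     \<not> completely_regular_T1 T \<and> \<not> functionally_Hausdorff T"
proof -
  interpret Z: inseparable_pair cork cork_left cork_right
  proof
    show "\<exists>K. compactin cork K \<and> A \<subseteq> K" if "countable A" "A \<subseteq> topspace cork" for A
      using countable_subset_compact_cork[of A] that by simp
  qed (use regular_T1_cork cork_ends_inseparable in auto)
  obtain \<eta> :: "(int \<Rightarrow> ordw) \<times> int \<Rightarrow> real set" where "inj \<eta>"
    using inj_cork_code by blast
  then have inj: "inj (image \<eta>)" by (intro injI) (simp add: inj_image_eq_iff)
  \<comment> \<open>Off the codes the collapsed point is the default, so that the range is exactly
    \<open>Z.hyp\<close>.\<close>
  define \<xi> where "\<xi> s = (if s \<in> image \<eta> ` Z.hyp then inv_into UNIV (image \<eta>) s else {cork_right})" for s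
  have \<xi>: "range \<xi> = Z.hyp"
  proof (intro equalityI subsetI)
    fix T assume "T \<in> Z.hyp"
    then have "\<xi> (\<eta> ` T) = T" using inj by (auto simp: \<xi>_def)
    then show "T \<in> range \<xi>" by (metis rangeI)
  qed (use inj Z.b_in_hyp in \<open>auto simp: \<xi>_def\<close>)
  obtain J :: "(nat \<Rightarrow> real set set) \<Rightarrow> real set set" where "inj J"
    using inj_sequences by blast
  have unc: "uncountable (UNIV :: real set set set)"
  proof
    assume "countable (UNIV :: real set set set)"
    then have "countable (range (\<lambda>x :: real. {{x}}))"
      by (rule countable_subset[rotated]) simp
    then have "countable (UNIV :: real set)"
      by (rule countable_image_inj_on) (simp add: inj_on_def)
    then show False using uncountable_UNIV_real by simp
  qed
  obtain f :: "real set set set \<Rightarrow> ((int \<Rightarrow> ordw) \<times> int) set" where f: "\<And>g. f g \<in> Z.hyp"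
    "\<And>C t. countable C \<Longrightarrow> \<forall>c\<in>C. countable c \<Longrightarrow> t ` C \<subseteq> Z.hyp \<Longrightarrow>
      \<exists>g. countable g \<and> (\<forall>h\<in>C. f (sd g h) = t h)"
    using korovin_map_exists[OF \<open>inj J\<close> unc, of \<xi>] unfolding \<xi> by blast
  interpret K: korovin Z.hyptop "{T \<in> Z.hyp. finite T}" f "{cork_left}" "{cork_right}"
  proof
    show "\<exists>d\<in>{T \<in> Z.hyp. finite T}. d \<in> U" if "openin Z.hyptop U" "U \<noteq> {}" for U
      using Z.hyp_finite_dense[OF that] openin_subset[OF that(1)] by auto
  qed (use Z.regular_T1_hyptop Z.R_rigid_hyptop Z.countable_finite_hyp_compact Z.a_in_hyp Z.b_in_hyp f
      in auto)
  have mem: "{} \<in> topspace K.ktop" "{{}} \<in> topspace K.ktop" by simp_all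
  have const: "\<phi> {{}} = \<phi> {}" if "continuous_map K.ktop euclideanreal \<phi>" for \<phi>
  proof -
    obtain c where "\<forall>x\<in>topspace K.ktop. \<phi> x = c"
      using K.R_rigid_ktop \<open>continuous_map K.ktop euclideanreal \<phi>\<close> unfolding R_rigid_def by blast
    then show ?thesis using mem by simp
  qed
  have "infinite (range (\<lambda>x :: real set set. {x}))"
  proof
    assume "finite (range (\<lambda>x :: real set set. {x}))"
    then have "finite (UNIV :: real set set set)"
      by (rule finite_imageD) (simp add: inj_on_def)
    then show False using unc countable_finite by blast
  qed
  then have "infinite (carrier (sd_group :: real set set set monoid))"
    by (rule infinite_super[rotated]) auto
  moreover have "\<not> functionally_Hausdorff K.ktop"
  proof
    assume "functionally_Hausdorff K.ktop"
    then have "\<exists>\<phi>. continuous_map K.ktop euclideanreal \<phi> \<and> \<phi> {{}} \<noteq> \<phi> {}"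
      unfolding functionally_Hausdorff_def using mem by simp
    then show False using const by blast
  qed
  moreover have "\<not> completely_regular_T1 K.ktop"
  proof
    assume cr: "completely_regular_T1 K.ktop"
    then have "t1_space K.ktop" by (simp add: completely_regular_T1_def)
    \<comment> \<open>Here \<open>{{}}\<close> is the closed set whose only point is the neutral
      element; at the left of the next line it is the group element whose only member is the empty
      set.\<close>
    then have "closedin K.ktop {{}}" using mem(1) by (rule closedin_t1_singleton)
    moreover have "{{}} \<in> topspace K.ktop - {{}}" using mem(2) by simp
    ultimately have "\<exists>\<phi>. continuous_map K.ktop euclideanreal \<phi> \<and> \<phi> {{}} = 1 \<and> \<phi> ` {{}} \<subseteq> {0}"
      using cr unfolding completely_regular_T1_def by (elim conjE allE impE) (rule conjI, assumption+)
    then obtain \<phi> where "continuous_map K.ktop euclideanreal \<phi>" "\<phi> {{}} = 1" "\<phi> {} = 0"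
      by auto
    then show False using const[of \<phi>] by simp
  qed
  ultimately show ?thesis
    using K.quasitopological_group_ktop K.regular_T1_ktop K.feebly_compact_ktop K.R_rigid_ktop
    by (intro exI[of _ sd_group] exI[of _ K.ktop] conjI)
qed

end
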